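(* Let $n=1$, let $\delta>0$, $\mu>0$, $\kappa>0$ and $0<\theta\le 2$ be fixed. For $u_0\in H^2(\mathbf{R})$ and $u_1\in H^\theta(\mathbf{R})$ let $u$ be the solution of $$u_{tt}+\delta(-\Delta)^\theta u_{tt}+\mu\Delta^2u-\kappa\Delta u=0\ \text{ in }(0,\infty)\times\mathbf{R},\qquad u(0,x)=u_0(x),\ u_t(0,x)=u_1(x).$$ (i) There is a constant $C_1>0$ such that, for all $u_0\in H^2(\mathbf{R})$ and $u_1\in H^\theta(\mathbf{R})\cap L^1(\mathbf{R})$, $$\|u(t,\cdot)\|_{L^2(\mathbf{R})}\le C_1 I_{0,1}\sqrt{t}\qquad\text{for all sufficiently large } t,$$ where $I_{0,1}:=\|u_1\|_{L^2(\mathbf{R})}+\|u_1\|_{L^1(\mathbf{R})}$. (ii) For every $\gamma\in(\tfrac12,1]$ there is a constant $C_2>0$ such that, for all $u_0\in H^2(\mathbf{R})$ and $u_1\in H^\theta(\mathbf{R})\cap L^{1,\gamma}(\mathbf{R})$, $$C_2\left|\int_{\mathbf{R}}u_1(x)\,dx\right|\sqrt{t}\le\|u(t,\cdot)\|_{L^2(\mathbf{R})}\qquad\text{for all sufficiently large } t.$$ For the fixed values of $\delta,\mu,\kappa,\theta$, the constants $C_1,C_2$ depend only on the space dimension and $\gamma$ (in particular not on the data or on $t$).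
   Context: The Fourier transform is $\hat f(\xi)=\int_{\mathbf{R}^n}e^{-ix\cdot\xi}f(x)\,dx$, and $(-\Delta)^\theta u:=\mathcal{F}^{-1}(|\xi|^{2\theta}\hat u)$. $L^{1,\gamma}(\mathbf{R}^n)$ is the set of $f\in L^1(\mathbf{R}^n)$ with $\|f\|_{1,\gamma}:=\int_{\mathbf{R}^n}(1+|x|^\gamma)|f(x)|\,dx<\infty$. "The solution" is the unique mild solution $u\in C([0,\infty);H^2(\mathbf{R}^n))\cap C^1([0,\infty);H^\theta(\mathbf{R}^n))$; on the Fourier side it is given by $$\hat u(t,\xi)=\cos(tf(|\xi|))\hat u_0(\xi)+\frac{\sin(tf(|\xi|))}{f(|\xi|)}\hat u_1(\xi),\qquad f(r)=\sqrt{\frac{\mu r^4+\kappa r^2}{1+\delta r^{2\theta}}}.$$ "For all sufficiently large $t$" means: there is $T>0$, which may depend on the data $u_0,u_1$ and on the parameters, such that the estimate holds for all $t\ge T$.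
   Formalization: In part (i) the data with u_1 = 0 and u_0 ≠ 0 (almost everywhere) are excluded, since there I_{0,1} = 0 while the L^2 norm of u(t) stays positive, so the stated bound fails. *)

theory Defs
  imports "HOL-Analysis.Analysis"
begin

text \<open>
  Elements of the function spaces are Borel functions \<open>real \<Rightarrow> complex\<close>; every Lebesgue class has a
  Borel representative, and all notions below are invariant under changes on null sets.
\<close>

definition L2_space :: "(real \<Rightarrow> complex) set" where
  "L2_space = {f \<in> borel_measurable lborel. integrable lborel (\<lambda>x. (cmod (f x))\<^sup>2)}"

definition L2_norm :: "(real \<Rightarrow> complex) \<Rightarrow> real" where
  "L2_norm f = sqrt (LINT x|lborel. (cmod (f x))\<^sup>2)"

definition L1_space :: "(real \<Rightarrow> complex) set" where
  "L1_space = {f. integrable lborel f}"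

definition L1_norm :: "(real \<Rightarrow> complex) \<Rightarrow> real" where
  "L1_norm f = (LINT x|lborel. cmod (f x))"

definition weighted_L1_space :: "real \<Rightarrow> (real \<Rightarrow> complex) set" where
  "weighted_L1_space \<gamma> =
     {f \<in> L1_space. integrable lborel (\<lambda>x. (1 + \<bar>x\<bar> powr \<gamma>) * cmod (f x))}"

definition fourier_L1 :: "(real \<Rightarrow> complex) \<Rightarrow> real \<Rightarrow> complex" where
  "fourier_L1 f \<xi> = (LINT x|lborel. exp (- (\<i> * complex_of_real (x * \<xi>))) * f x)"

text \<open>
  The Fourier--Plancherel transform on \<open>L\<^sup>2\<close>: the limit in \<open>L\<^sup>2\<close> of the transforms of the
  truncations of \<open>f\<close> to \<open>[-R, R]\<close>. The limit is unique only almost everywhere, so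
  \<open>fourier_L2\<close> picks a representative.
\<close>

definition has_fourier_L2 :: "(real \<Rightarrow> complex) \<Rightarrow> (real \<Rightarrow> complex) \<Rightarrow> bool" where
  "has_fourier_L2 f g \<longleftrightarrow> f \<in> L2_space \<and> g \<in> L2_space \<and>
     ((\<lambda>R. L2_norm (\<lambda>\<xi>. g \<xi> - fourier_L1 (\<lambda>x. indicator {-R..R} x * f x) \<xi>))
        \<longlongrightarrow> 0) at_top"

definition fourier_L2 :: "(real \<Rightarrow> complex) \<Rightarrow> real \<Rightarrow> complex" where
  "fourier_L2 f = (SOME g. has_fourier_L2 f g)"

definition sobolev :: "real \<Rightarrow> (real \<Rightarrow> complex) set" where
  "sobolev s = {f \<in> L2_space. \<exists>g. has_fourier_L2 f g \<and>
     integrable lborel (\<lambda>\<xi>. (1 + \<xi>\<^sup>2) powr s * (cmod (g \<xi>))\<^sup>2)}"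

definition sobolev_norm :: "real \<Rightarrow> (real \<Rightarrow> complex) \<Rightarrow> real" where
  "sobolev_norm s f = sqrt (LINT \<xi>|lborel. (1 + \<xi>\<^sup>2) powr s * (cmod (fourier_L2 f \<xi>))\<^sup>2)"

text \<open>\<open>u \<in> C([0,\<infinity>); H\<^sup>s)\<close>\<close>

definition continuous_sobolev :: "real \<Rightarrow> (real \<Rightarrow> real \<Rightarrow> complex) \<Rightarrow> bool" where
  "continuous_sobolev s u \<longleftrightarrow> (\<forall>t\<ge>0. u t \<in> sobolev s) \<and>
     (\<forall>t\<ge>0. ((\<lambda>\<tau>. sobolev_norm s (\<lambda>x. u \<tau> x - u t x)) \<longlongrightarrow> 0) (at t within {0..}))"

text \<open>\<open>u \<in> C\<^sup>1([0,\<infinity>); H\<^sup>s)\<close> with time derivative \<open>v\<close> (one-sided at \<open>t = 0\<close>)\<close>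

definition C1_sobolev ::
  "real \<Rightarrow> (real \<Rightarrow> real \<Rightarrow> complex) \<Rightarrow> (real \<Rightarrow> real \<Rightarrow> complex) \<Rightarrow> bool" where
  "C1_sobolev s u v \<longleftrightarrow> continuous_sobolev s u \<and> continuous_sobolev s v \<and>
     (\<forall>t\<ge>0. ((\<lambda>\<tau>. sobolev_norm s (\<lambda>x. (u \<tau> x - u t x) /\<^sub>R (\<tau> - t) - v t x))
        \<longlongrightarrow> 0) (at t within {0..}))"

text \<open>
  Mild solution of \<open>u\<^sub>t\<^sub>t + \<delta>(-\<Delta>)\<^sup>\<theta>u\<^sub>t\<^sub>t + \<mu>\<Delta>\<^sup>2u - \<kappa>\<Delta>u = 0\<close>, \<open>u(0) = u0\<close>, \<open>u\<^sub>t(0) = u1\<close>, in the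
  sense of the first-order system \<open>U' = AU\<close> for \<open>U = (u, u\<^sub>t)\<close> in \<open>H\<^sup>2 \<times> H\<^sup>\<theta>\<close>, i.e.
  \<open>U(t) = U(0) + A \<integral>\<^sub>0\<^sup>t U(s) ds\<close>. The first component of this equation says that \<open>v\<close> is the time
  derivative of \<open>u\<close>. The second one is the time-integrated equation
  \<open>(1 + \<delta>(-\<Delta>)\<^sup>\<theta>)(u\<^sub>t(t) - u1) + (\<mu>\<Delta>\<^sup>2 - \<kappa>\<Delta>) \<integral>\<^sub>0\<^sup>t u(s) ds = 0\<close>,
  stated on the Fourier side since its terms are in general only tempered distributions.
  The integral of the continuous \<open>H\<^sup>2\<close>-valued function \<open>u\<close> enters as \<open>w\<close>, its unique \<open>C\<^sup>1\<close> primitive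
  in \<open>H\<^sup>2\<close> that vanishes at \<open>0\<close>.
\<close>

definition mild_solution ::
  "real \<Rightarrow> real \<Rightarrow> real \<Rightarrow> real \<Rightarrow> (real \<Rightarrow> complex) \<Rightarrow> (real \<Rightarrow> complex)
     \<Rightarrow> (real \<Rightarrow> real \<Rightarrow> complex) \<Rightarrow> bool" where
  "mild_solution \<delta> \<mu> \<kappa> \<theta> u0 u1 u \<longleftrightarrow>
     continuous_sobolev 2 u \<and>
     (\<exists>v w. C1_sobolev \<theta> u v \<and>
        (AE x in lborel. u 0 x = u0 x) \<and> (AE x in lborel. v 0 x = u1 x) \<and>
        C1_sobolev 2 w u \<and> (AE x in lborel. w 0 x = 0) \<and>
        (\<forall>t\<ge>0. AE \<xi> in lborel.
           complex_of_real (1 + \<delta> * \<bar>\<xi>\<bar> powr (2 * \<theta>)) * (fourier_L2 (v t) \<xi> - fourier_L2 u1 \<xi>)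
           + complex_of_real (\<mu> * \<xi> ^ 4 + \<kappa> * \<xi>\<^sup>2) * fourier_L2 (w t) \<xi> = 0))"

end

theory Submission
  imports Defs "HOL-Probability.Probability"
begin

text \<open>
  Write \<open>F\<close> for the Fourier transform. On the Fourier side the equation is, for each \<open>\<xi>\<close>, a
  harmonic oscillator with frequency \<open>\<phi> = f(|\<xi>|)\<close>, so that
  \<open>F u(t) = cos (t \<phi>) F u(0) + sin (t \<phi>) / \<phi> F u\<^sub>1\<close>. By Plancherel the first term stays bounded
  in \<open>L\<^sup>2\<close>. Since \<open>\<phi>\<close> is comparable to \<open>|\<xi>|\<close> near \<open>0\<close> and bounded below away from \<open>0\<close>, the
  second term is concentrated on the scale \<open>|\<xi>| ~ 1/t\<close>, where the multiplier has size \<open>t\<close> and hence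
  \<open>L\<^sup>2\<close> norm of order \<open>sqrt t\<close>, while \<open>F u\<^sub>1(\<xi>)\<close> is bounded by the \<open>L\<^sup>1\<close> norm of \<open>u\<^sub>1\<close> and
  converges to the integral of \<open>u\<^sub>1\<close> as \<open>\<xi> \<rightarrow> 0\<close>.
\<close>

subsection \<open>The space \<open>L\<^sup>2\<close>\<close>

text \<open>The explicit formula is therefore derived by an argument in L^2 norm. That argument
  wants a bounded frequency, while \<open>\<phi>\<close> is unbounded for
  \<open>\<theta> < 2\<close>; hence it is run on bounded bands that exhaust the line. Plancherel is
  obtained by damping |F f|^2 with a wide Gaussian, which turns its integral into an average of the
  autocorrelation of \<open>f\<close> near 0. The constants come from the dispersion relation alone.
  Whatever depends on the data, namely the size of the cosine term and the interval on which F
  \<open>u1\<close> is close to its value at 0, enters only the time \<open>T\<close>. In (i) the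
  cosine term is absorbed by a multiple of \<open>sqrt t\<close> whose coefficient is zero when
  \<open>u1\<close> is null; this is the origin of the condition that \<open>u1\<close> is not
  almost everywhere 0 or \<open>u0\<close> is.\<close>

lemma L2_space_measurable [measurable_dest]: "f \<in> L2_space \<Longrightarrow> f \<in> borel_measurable borel"
  by (simp add: L2_space_def)

lemma L2_space_integrable: "f \<in> L2_space \<Longrightarrow> integrable lborel (\<lambda>x. (cmod (f x))\<^sup>2)"
  by (simp add: L2_space_def)

lemma L2_norm_nonneg [simp]: "0 \<le> L2_norm f"
  by (simp add: L2_norm_def)

lemma L2_norm_power2: "(L2_norm f)\<^sup>2 = (LINT x|lborel. (cmod (f x))\<^sup>2)"
  by (simp add: L2_norm_def)

lemma L2_norm_minus_commute: "L2_norm (\<lambda>x. f x - g x) = L2_norm (\<lambda>x. g x - f x)"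
  by (simp add: L2_norm_def norm_minus_commute)

lemma L2_space_bound:
  assumes "g \<in> L2_space" and [measurable]: "f \<in> borel_measurable borel"
    and "AE x in lborel. cmod (f x) \<le> C * cmod (g x)"
  shows "f \<in> L2_space"
proof -
  have "integrable lborel (\<lambda>x. C\<^sup>2 * (cmod (g x))\<^sup>2)"
    using L2_space_integrable[OF assms(1)] by simp
  then have "integrable lborel (\<lambda>x. (cmod (f x))\<^sup>2)"
  proof (rule Bochner_Integration.integrable_bound)
    show "AE x in lborel. norm ((cmod (f x))\<^sup>2) \<le> norm (C\<^sup>2 * (cmod (g x))\<^sup>2)"
      using assms(3)
    proof eventually_elim
      case (elim x)
      then have "(cmod (f x))\<^sup>2 \<le> (C * cmod (g x))\<^sup>2"
        by (intro power_mono) auto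
      then show ?case by (simp add: power_mult_distrib)
    qed
  qed simp
  then show ?thesis by (simp add: L2_space_def)
qed

text \<open>Membership of \<open>g\<close> guards against the default value of the integral: for a
  \<open>g\<close> that is not square-integrable the right-hand side would be 0.\<close>

lemma L2_norm_bound:
  assumes "g \<in> L2_space" and [measurable]: "f \<in> borel_measurable borel"
    and "AE x in lborel. cmod (f x) \<le> C * cmod (g x)" and "0 \<le> C"
  shows "L2_norm f \<le> C * L2_norm g"
proof -
  have "(LINT x|lborel. (cmod (f x))\<^sup>2) \<le> (LINT x|lborel. C\<^sup>2 * (cmod (g x))\<^sup>2)"
  proof (rule integral_mono_AE)
    show "integrable lborel (\<lambda>x. (cmod (f x))\<^sup>2)"
      by (rule L2_space_integrable, rule L2_space_bound) fact+
    show "integrable lborel (\<lambda>x. C\<^sup>2 * (cmod (g x))\<^sup>2)"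
      using L2_space_integrable[OF assms(1)] by simp
    show "AE x in lborel. (cmod (f x))\<^sup>2 \<le> C\<^sup>2 * (cmod (g x))\<^sup>2"
      using assms(3)
    proof eventually_elim
      case (elim x)
      then have "(cmod (f x))\<^sup>2 \<le> (C * cmod (g x))\<^sup>2"
        by (intro power_mono) auto
      then show ?case by (simp add: power_mult_distrib)
    qed
  qed
  also have "\<dots> = (C * L2_norm g)\<^sup>2"
    by (simp add: power_mult_distrib L2_norm_power2)
  finally have "(L2_norm f)\<^sup>2 \<le> (C * L2_norm g)\<^sup>2"
    by (simp add: L2_norm_power2)
  then show ?thesis
    using assms(4) by (simp add: power2_le_iff_abs_le)
qed

lemma L2_norm_cong_AE:
  assumes [measurable]: "f \<in> borel_measurable borel" "g \<in> borel_measurable borel"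
    and "AE x in lborel. f x = g x"
  shows "L2_norm f = L2_norm g"
proof -
  have "(LINT x|lborel. (cmod (f x))\<^sup>2) = (LINT x|lborel. (cmod (g x))\<^sup>2)"
    using assms(3) by (intro integral_cong_AE) (measurable, auto elim: eventually_mono)
  then show ?thesis by (simp add: L2_norm_def)
qed

lemma L2_space_add:
  assumes f: "f \<in> L2_space" and g: "g \<in> L2_space"
  shows "(\<lambda>x. f x + g x) \<in> L2_space"
proof -
  note [measurable] = f[THEN L2_space_measurable] g[THEN L2_space_measurable]
  have "integrable lborel (\<lambda>x. 2 * (cmod (f x))\<^sup>2 + 2 * (cmod (g x))\<^sup>2)"
    using L2_space_integrable[OF f] L2_space_integrable[OF g] by simp
  then have "integrable lborel (\<lambda>x. (cmod (f x + g x))\<^sup>2)"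
  proof (rule Bochner_Integration.integrable_bound)
    have "(cmod (f x + g x))\<^sup>2 \<le> 2 * (cmod (f x))\<^sup>2 + 2 * (cmod (g x))\<^sup>2" for x
    proof -
      have "(cmod (f x + g x))\<^sup>2 \<le> (cmod (f x) + cmod (g x))\<^sup>2"
        by (intro power_mono norm_triangle_ineq) simp
      also have "\<dots> \<le> 2 * (cmod (f x))\<^sup>2 + 2 * (cmod (g x))\<^sup>2"
        using sum_squares_bound[of "cmod (f x)" "cmod (g x)"] by (simp add: power2_sum)
      finally show ?thesis .
    qed
    then show "AE x in lborel. norm ((cmod (f x + g x))\<^sup>2) \<le> norm (2 * (cmod (f x))\<^sup>2 + 2 * (cmod (g x))\<^sup>2)"
      by simp
  qed simp
  then show ?thesis by (simp add: L2_space_def)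
qed

lemma L2_space_mult_bounded:
  assumes "f \<in> L2_space" and [measurable]: "m \<in> borel_measurable borel" and "\<And>x. cmod (m x) \<le> C"
  shows "(\<lambda>x. m x * f x) \<in> L2_space"
proof (rule L2_space_bound[OF assms(1), of _ C])
  note [measurable] = assms(1)[THEN L2_space_measurable]
  show "(\<lambda>x. m x * f x) \<in> borel_measurable borel" by measurable
  show "AE x in lborel. cmod (m x * f x) \<le> C * cmod (f x)"
    using assms(3) by (intro always_eventually allI) (simp add: norm_mult mult_right_mono)
qed

lemma L2_space_cmult: "f \<in> L2_space \<Longrightarrow> (\<lambda>x. c * f x) \<in> L2_space"
  by (rule L2_space_mult_bounded[where C = "cmod c"]) auto

lemma L2_space_diff:
  assumes "f \<in> L2_space" and "g \<in> L2_space"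
  shows "(\<lambda>x. f x - g x) \<in> L2_space"
  using L2_space_add[OF assms(1) L2_space_cmult[OF assms(2), of "-1"]] by simp

lemma L2_norm_cmult: "L2_norm (\<lambda>x. c * f x) = cmod c * L2_norm f"
  by (simp add: L2_norm_def norm_mult power_mult_distrib real_sqrt_mult)

lemma L2_norm_zero_AE:
  assumes f: "f \<in> L2_space" and "L2_norm f = 0"
  shows "AE x in lborel. f x = 0"
  using integral_nonneg_eq_0_iff_AE[OF L2_space_integrable[OF f]] assms(2)
  by (simp add: L2_norm_def)

lemma integrable_mult_L2:
  assumes f: "f \<in> L2_space" and g: "g \<in> L2_space"
  shows "integrable lborel (\<lambda>x. f x * g x)"
proof -
  note [measurable] = f[THEN L2_space_measurable] g[THEN L2_space_measurable]
  have "integrable lborel (\<lambda>x. (cmod (f x))\<^sup>2 + (cmod (g x))\<^sup>2)"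
    using L2_space_integrable[OF f] L2_space_integrable[OF g] by simp
  then show ?thesis
  proof (rule Bochner_Integration.integrable_bound)
    have "cmod (f x) * cmod (g x) \<le> (cmod (f x))\<^sup>2 + (cmod (g x))\<^sup>2" for x
    proof -
      have "0 \<le> cmod (f x) * cmod (g x)" by simp
      then show ?thesis using sum_squares_bound[of "cmod (f x)" "cmod (g x)"] by linarith
    qed
    then show "AE x in lborel. norm (f x * g x) \<le> norm ((cmod (f x))\<^sup>2 + (cmod (g x))\<^sup>2)"
      by (simp add: norm_mult)
  qed simp
qed

text \<open>The inequality \<open>2 a b \<le> s a^2 + b^2 / s\<close> is integrated with the optimal
  weight \<open>s = B / A\<close>. Since \<open>A\<close> or \<open>B\<close> may be 0, both are
  first enlarged by \<open>e\<close>, which then tends to 0.\<close>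

lemma L2_Cauchy_Schwarz:
  assumes f: "f \<in> L2_space" and g: "g \<in> L2_space"
  shows "(LINT x|lborel. cmod (f x) * cmod (g x)) \<le> L2_norm f * L2_norm g"
proof -
  define A B where "A = L2_norm f" and "B = L2_norm g"
  have AB: "0 \<le> A" "0 \<le> B" by (auto simp: A_def B_def)
  have int: "integrable lborel (\<lambda>x. cmod (f x) * cmod (g x))"
    using integrable_norm[OF integrable_mult_L2[OF f g]] by (simp add: norm_mult)
  have le: "(LINT x|lborel. cmod (f x) * cmod (g x)) \<le> (A + e) * (B + e)" if e: "0 < e" for e
  proof -
    define s where "s = (B + e) / (A + e)"
    have s: "0 < s" using AB e by (auto simp: s_def)
    have "(LINT x|lborel. 2 * (cmod (f x) * cmod (g x)))
        \<le> (LINT x|lborel. s * (cmod (f x))\<^sup>2 + (cmod (g x))\<^sup>2 / s)"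
    proof (rule integral_mono)
      show "integrable lborel (\<lambda>x. s * (cmod (f x))\<^sup>2 + (cmod (g x))\<^sup>2 / s)"
        using L2_space_integrable[OF f] L2_space_integrable[OF g] by simp
      show "2 * (cmod (f x) * cmod (g x)) \<le> s * (cmod (f x))\<^sup>2 + (cmod (g x))\<^sup>2 / s" for x
      proof -
        have "0 \<le> (s * cmod (f x) - cmod (g x))\<^sup>2 / s" using s by simp
        also have "\<dots> = s * (cmod (f x))\<^sup>2 + (cmod (g x))\<^sup>2 / s - 2 * (cmod (f x) * cmod (g x))"
          using s by (simp add: power2_eq_square field_simps)
        finally show ?thesis by simp
      qed
    qed (use int in simp)
    also have "\<dots> = s * A\<^sup>2 + B\<^sup>2 / s"
      using L2_space_integrable[OF f] L2_space_integrable[OF g]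
      by (simp add: A_def B_def L2_norm_power2)
    also have "\<dots> \<le> s * (A + e)\<^sup>2 + (B + e)\<^sup>2 / s"
      using AB e s by (intro add_mono mult_left_mono divide_right_mono power_mono) auto
    also have "\<dots> = 2 * ((A + e) * (B + e))"
      using AB e by (simp add: s_def power2_eq_square)
    finally show ?thesis by simp
  qed
  have "((\<lambda>e. (A + e) * (B + e)) \<longlongrightarrow> (A + 0) * (B + 0)) (at_right 0)"
    by (intro tendsto_intros)
  then have "(LINT x|lborel. cmod (f x) * cmod (g x)) \<le> (A + 0) * (B + 0)"
  proof (rule tendsto_lowerbound)
    show "\<forall>\<^sub>F e in at_right 0. (LINT x|lborel. cmod (f x) * cmod (g x)) \<le> (A + e) * (B + e)"
      using le by (auto simp: eventually_at_right_field intro: exI[of _ 1])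
  qed simp
  then show ?thesis by (simp add: A_def B_def)
qed

lemma L2_norm_triangle:
  assumes f: "f \<in> L2_space" and g: "g \<in> L2_space"
  shows "L2_norm (\<lambda>x. f x + g x) \<le> L2_norm f + L2_norm g"
proof -
  have int: "integrable lborel (\<lambda>x. cmod (f x) * cmod (g x))"
    using integrable_norm[OF integrable_mult_L2[OF f g]] by (simp add: norm_mult)
  have "(L2_norm (\<lambda>x. f x + g x))\<^sup>2
      \<le> (LINT x|lborel. (cmod (f x))\<^sup>2 + (cmod (g x))\<^sup>2 + 2 * (cmod (f x) * cmod (g x)))"
    unfolding L2_norm_power2
  proof (rule integral_mono)
    show "integrable lborel (\<lambda>x. (cmod (f x + g x))\<^sup>2)"
      by (rule L2_space_integrable[OF L2_space_add[OF f g]])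
    show "(cmod (f x + g x))\<^sup>2 \<le> (cmod (f x))\<^sup>2 + (cmod (g x))\<^sup>2 + 2 * (cmod (f x) * cmod (g x))" for x
    proof -
      have "(cmod (f x + g x))\<^sup>2 \<le> (cmod (f x) + cmod (g x))\<^sup>2"
        by (intro power_mono norm_triangle_ineq) simp
      then show ?thesis by (simp add: power2_sum)
    qed
  qed (use int L2_space_integrable[OF f] L2_space_integrable[OF g] in simp)
  also have "\<dots> = (L2_norm f)\<^sup>2 + (L2_norm g)\<^sup>2 + 2 * (LINT x|lborel. cmod (f x) * cmod (g x))"
    using int L2_space_integrable[OF f] L2_space_integrable[OF g] by (simp add: L2_norm_power2)
  also have "\<dots> \<le> (L2_norm f + L2_norm g)\<^sup>2"
    using L2_Cauchy_Schwarz[OF f g] by (simp add: power2_sum)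
  finally show ?thesis
    by (simp add: power2_le_iff_abs_le)
qed

lemma L2_norm_diff_triangle:
  assumes "f \<in> L2_space" "g \<in> L2_space" "h \<in> L2_space"
  shows "L2_norm (\<lambda>x. f x - h x) \<le> L2_norm (\<lambda>x. f x - g x) + L2_norm (\<lambda>x. g x - h x)"
  using L2_norm_triangle[OF L2_space_diff[OF assms(1,2)] L2_space_diff[OF assms(2,3)]] by simp

lemma L2_norm_reverse_triangle:
  assumes f: "f \<in> L2_space" and g: "g \<in> L2_space"
  shows "\<bar>L2_norm f - L2_norm g\<bar> \<le> L2_norm (\<lambda>x. f x - g x)"
proof -
  have "L2_norm f \<le> L2_norm (\<lambda>x. f x - g x) + L2_norm g"
    using L2_norm_triangle[OF L2_space_diff[OF f g] g] by simp
  moreover have "L2_norm g \<le> L2_norm (\<lambda>x. g x - f x) + L2_norm f"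
    using L2_norm_triangle[OF L2_space_diff[OF g f] f] by simp
  ultimately show ?thesis
    using L2_norm_minus_commute[of f g] by simp
qed

lemma L2_norm_dominated_convergence:
  fixes s :: "nat \<Rightarrow> real \<Rightarrow> complex"
  assumes f [measurable]: "f \<in> borel_measurable borel"
    and s [measurable]: "\<And>n. s n \<in> borel_measurable borel" and w: "w \<in> L2_space"
    and lim: "AE x in lborel. (\<lambda>n. s n x) \<longlonglongrightarrow> f x"
    and bound: "\<And>n. AE x in lborel. cmod (s n x - f x) \<le> cmod (w x)"
  shows "(\<lambda>n. L2_norm (\<lambda>x. s n x - f x)) \<longlonglongrightarrow> 0"
proof -
  have "(\<lambda>n. LINT x|lborel. (cmod (s n x - f x))\<^sup>2) \<longlonglongrightarrow> (LINT x::real|lborel. (0::real))"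
  proof (rule integral_dominated_convergence[where w = "\<lambda>x. (cmod (w x))\<^sup>2"])
    show "AE x in lborel. (\<lambda>n. (cmod (s n x - f x))\<^sup>2) \<longlonglongrightarrow> 0"
      using lim
    proof eventually_elim
      case (elim x)
      then have "(\<lambda>n. s n x - f x) \<longlonglongrightarrow> 0" using LIM_zero by blast
      then have "(\<lambda>n. (cmod (s n x - f x))\<^sup>2) \<longlonglongrightarrow> (cmod 0)\<^sup>2" by (intro tendsto_intros)
      then show ?case by simp
    qed
    show "AE x in lborel. norm ((cmod (s n x - f x))\<^sup>2) \<le> (cmod (w x))\<^sup>2" for n
      using bound[of n] by eventually_elim (auto intro: power_mono)
  qed (use L2_space_integrable[OF w] in simp_all)
  then have "(\<lambda>n. sqrt (LINT x|lborel. (cmod (s n x - f x))\<^sup>2)) \<longlonglongrightarrow> sqrt 0"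
    by (intro tendsto_intros) simp
  then show ?thesis by (simp add: L2_norm_def)
qed

text \<open>The junk value \<open>L2_norm h = 0\<close> for \<open>h \<notin> L2_space\<close> is why membership is part of the conclusion.\<close>

lemma L2_norm_Fatou:
  fixes s :: "nat \<Rightarrow> real \<Rightarrow> complex"
  assumes f [measurable]: "f \<in> borel_measurable borel"
    and s: "\<And>n. s n \<in> L2_space" and lim: "AE x in lborel. (\<lambda>n. s n x) \<longlonglongrightarrow> f x"
    and bound: "\<And>n. L2_norm (s n) \<le> B n" and B: "B \<longlonglongrightarrow> B0"
  shows "f \<in> L2_space" and "L2_norm f \<le> B0"
proof -
  note [measurable] = s[THEN L2_space_measurable]
  have B0: "0 \<le> B0"
    by (rule LIMSEQ_le_const[OF B]) (use bound L2_norm_nonneg order_trans in blast)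
  have "(\<integral>\<^sup>+x. ennreal ((cmod (f x))\<^sup>2) \<partial>lborel)
      = (\<integral>\<^sup>+x. liminf (\<lambda>n. ennreal ((cmod (s n x))\<^sup>2)) \<partial>lborel)"
  proof (rule nn_integral_cong_AE)
    show "AE x in lborel. ennreal ((cmod (f x))\<^sup>2) = liminf (\<lambda>n. ennreal ((cmod (s n x))\<^sup>2))"
      using lim
    proof eventually_elim
      case (elim x)
      then have "(\<lambda>n. ennreal ((cmod (s n x))\<^sup>2)) \<longlonglongrightarrow> ennreal ((cmod (f x))\<^sup>2)"
        by (intro tendsto_intros) 
      then show ?case by (intro lim_imp_Liminf[symmetric]) simp_all
    qed
  qed
  also have "\<dots> \<le> liminf (\<lambda>n. \<integral>\<^sup>+x. ennreal ((cmod (s n x))\<^sup>2) \<partial>lborel)"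
    by (rule nn_integral_liminf) auto
  also have "\<dots> = liminf (\<lambda>n. ennreal ((L2_norm (s n))\<^sup>2))"
    using s by (simp add: L2_norm_power2 nn_integral_eq_integral L2_space_integrable)
  also have "\<dots> \<le> liminf (\<lambda>n. ennreal ((B n)\<^sup>2))"
    by (intro Liminf_mono always_eventually allI ennreal_leI power_mono bound) simp
  also have "\<dots> = ennreal (B0\<^sup>2)"
    by (rule lim_imp_Liminf) (auto intro!: tendsto_intros B)
  finally have le: "(\<integral>\<^sup>+x. ennreal ((cmod (f x))\<^sup>2) \<partial>lborel) \<le> ennreal (B0\<^sup>2)" .
  then have int: "integrable lborel (\<lambda>x. (cmod (f x))\<^sup>2)"
    by (intro integrableI_bounded) (auto simp: top.extremum_strict le_less_trans ennreal_less_top)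
  then show "f \<in> L2_space" by (simp add: L2_space_def)
  have "ennreal ((L2_norm f)\<^sup>2) \<le> ennreal (B0\<^sup>2)"
    using le int by (simp add: L2_norm_power2 nn_integral_eq_integral)
  then show "L2_norm f \<le> B0"
    using B0 by (simp add: power2_le_iff_abs_le)
qed

subsection \<open>Continuity of translations in \<open>L\<^sup>2\<close>\<close>

lemma L2_space_bounded_supportI:
  assumes [measurable]: "f \<in> borel_measurable borel"
    and "\<And>x. cmod (f x) \<le> C" and "\<And>x. R < \<bar>x\<bar> \<Longrightarrow> f x = 0"
  shows "f \<in> L2_space"
proof -
  have "integrable lborel (\<lambda>x. C\<^sup>2 * indicator {-R..R} x :: real)"
    by (intro integrable_mult_right integrable_real_indicator) (auto simp: emeasure_lborel_Icc_eq)
  then have "integrable lborel (\<lambda>x. (cmod (f x))\<^sup>2)"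
  proof (rule Bochner_Integration.integrable_bound)
    have "(cmod (f x))\<^sup>2 \<le> C\<^sup>2 * indicator {-R..R} x" for x
    proof (cases "R < \<bar>x\<bar>")
      case False
      then show ?thesis using power_mono[OF assms(2)[of x], of 2] by (auto simp: indicator_def)
    qed (use assms(3) in simp)
    then show "AE x in lborel. norm ((cmod (f x))\<^sup>2) \<le> norm (C\<^sup>2 * indicator {-R..R} x :: real)"
      by (intro always_eventually allI) simp
  qed simp
  then show ?thesis by (simp add: L2_space_def)
qed

text \<open>For \<open>k > 0\<close> this is the radial retraction onto the disc of radius
  \<open>k\<close>. Being continuous, it bounds a continuous approximant without destroying its
  continuity.\<close>

definition clip :: "real \<Rightarrow> complex \<Rightarrow> complex" where
  "clip k z = z / complex_of_real (max 1 (cmod z / k))"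

lemma norm_clip: "cmod (clip k z) = cmod z / max 1 (cmod z / k)"
  by (simp add: clip_def norm_divide)

lemma norm_clip_le: "cmod (clip k z) \<le> cmod z"
  using divide_left_mono[of 1 "max 1 (cmod z / k)" "cmod z"] by (simp add: norm_clip)

lemma norm_clip_le_bound: "0 < k \<Longrightarrow> cmod (clip k z) \<le> k"
  unfolding norm_clip by (simp add: pos_divide_le_eq less_max_iff_disj) (simp add: max_def field_simps)

lemma continuous_on_clip: "continuous_on UNIV (clip k)"
  unfolding clip_def divide_inverse[of _ k]
  by (intro continuous_intros) (auto simp: max_def)

lemma clip_eq: "0 < k \<Longrightarrow> cmod z \<le> k \<Longrightarrow> clip k z = z"
  by (simp add: clip_def max_def)

definition cutoff :: "real \<Rightarrow> real \<Rightarrow> real" where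
  "cutoff k x = max 0 (min 1 (k + 1 - \<bar>x\<bar>))"

lemma cutoff_bounds: "0 \<le> cutoff k x" "cutoff k x \<le> 1"
  by (auto simp: cutoff_def)

lemma cutoff_eq_1: "\<bar>x\<bar> \<le> k \<Longrightarrow> cutoff k x = 1"
  by (simp add: cutoff_def)

lemma cutoff_eq_0: "k + 1 < \<bar>x\<bar> \<Longrightarrow> cutoff k x = 0"
  by (simp add: cutoff_def)

lemma continuous_on_cutoff: "continuous_on UNIV (cutoff k)"
  unfolding cutoff_def by (intro continuous_intros)

lemma cutoff_clip_norm_le:
  assumes "0 < k" shows "cmod (complex_of_real (cutoff k x) * clip k z) \<le> k" (is ?a)
    and "cmod (complex_of_real (cutoff k x) * clip k z) \<le> cmod z" (is ?b)
proof -
  have "cmod (complex_of_real (cutoff k x) * clip k z) \<le> cmod (clip k z)"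
    using cutoff_bounds[of k x] by (simp add: norm_mult mult_left_le_one_le)
  then show ?a ?b
    using norm_clip_le_bound[OF assms, of z] norm_clip_le[of k z] by linarith+
qed

text \<open>Two approximations are combined. Cutting off and clipping \<open>f\<close> gives
  \<open>h n\<close>, bounded and of compact support, which converges to \<open>f\<close> by
  domination. Continuous functions \<open>G m\<close> that converge to \<open>f\<close> almost
  everywhere come without any bound, so the same cutoff and clip are applied to them; the results
  converge to the fixed \<open>h n\<close> under one compactly supported majorant.\<close>

lemma L2_approx_continuous:
  assumes f: "f \<in> L2_space" and e: "0 < e"
  obtains g R C where "continuous_on UNIV g" "\<forall>x. R < \<bar>x\<bar> \<longrightarrow> g x = 0"
    "\<forall>x. cmod (g x) \<le> C" "L2_norm (\<lambda>x. f x - g x) < e"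
proof -
  note [measurable] = f[THEN L2_space_measurable]
  have [measurable]: "clip k \<in> borel_measurable borel" "cutoff k \<in> borel_measurable borel" for k
    using continuous_on_clip continuous_on_cutoff by (auto intro: borel_measurable_continuous_onI)
  define h where "h = (\<lambda>n x. complex_of_real (cutoff (real (Suc n)) x) * clip (real (Suc n)) (f x))"
  have h_le: "cmod (h n x) \<le> cmod (f x)" for n x
    unfolding h_def by (rule cutoff_clip_norm_le) simp
  have h_meas [measurable]: "h n \<in> borel_measurable borel" for n
    unfolding h_def by measurable
  have h_L2: "h n \<in> L2_space" for n
    by (rule L2_space_bound[OF f, of _ 1]) (use h_le in auto)
  have "(\<lambda>n. L2_norm (\<lambda>x. h n x - f x)) \<longlonglongrightarrow> 0"
  proof (rule L2_norm_dominated_convergence[OF _ _ L2_space_cmult[OF f, of 2]])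
    have "(\<lambda>n. h n x) \<longlonglongrightarrow> f x" for x
    proof (rule tendsto_eventually)
      have "\<forall>\<^sub>F n in sequentially. max \<bar>x\<bar> (cmod (f x)) < real n"
        by (rule filterlim_at_top_dense[THEN iffD1, rule_format, OF filterlim_real_sequentially])
      then show "\<forall>\<^sub>F n in sequentially. h n x = f x"
        by eventually_elim (auto simp: h_def cutoff_eq_1 clip_eq)
    qed
    then show "AE x in lborel. (\<lambda>n. h n x) \<longlonglongrightarrow> f x" by simp
    have "cmod (h n x - f x) \<le> cmod (2 * f x)" for n x
      using norm_triangle_ineq4[of "h n x" "f x"] h_le[of n x] by (simp add: norm_mult)
    then show "AE x in lborel. cmod (h n x - f x) \<le> cmod (2 * f x)" for n
      by simp
  qed simp_all
  then have "\<forall>\<^sub>F n in sequentially. L2_norm (\<lambda>x. h n x - f x) < e / 2"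
    by (rule order_tendstoD) (use e in simp)
  then obtain n where n: "L2_norm (\<lambda>x. h n x - f x) < e / 2"
    by (auto simp: eventually_sequentially)
  \<comment> \<open>Source of the continuous functions: \<open>measurable_on\<close> means being
    their pointwise limit off a negligible set.\<close>
  have "f measurable_on UNIV"
    by (rule lebesgue_measurable_imp_measurable_on) (auto intro: measurable_completion)
  then obtain N G where N: "negligible N" and G: "\<And>n. continuous_on UNIV (G n)"
    and lim: "\<And>x. x \<notin> N \<Longrightarrow> (\<lambda>n. G n x) \<longlonglongrightarrow> f x"
    by (auto simp: measurable_on_def)
  have AE_N: "AE x in lborel. x \<notin> N"
    using N AE_not_in[of N lebesgue] by (simp add: negligible_iff_null_sets AE_completion_iff)
  define k where "k = real (Suc n)"
  have k: "0 < k" by (simp add: k_def)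
  define g where "g = (\<lambda>m x. complex_of_real (cutoff k x) * clip k (G m x))"
  have g_cont: "continuous_on UNIV (g m)" for m
    unfolding g_def
    by (intro continuous_intros continuous_on_compose2[OF continuous_on_clip] G
        continuous_on_compose2[OF continuous_on_cutoff]) auto
  then have [measurable]: "g m \<in> borel_measurable borel" for m
    by (auto intro: borel_measurable_continuous_onI)
  have g_supp: "g m x = 0" if "k + 1 < \<bar>x\<bar>" for m x
    using that by (simp add: g_def cutoff_eq_0)
  have g_le: "cmod (g m x) \<le> k" for m x
    unfolding g_def by (rule cutoff_clip_norm_le) (rule k)
  have g_L2: "g m \<in> L2_space" for m
    by (rule L2_space_bounded_supportI[OF _ g_le g_supp]) auto
  have "(\<lambda>m. L2_norm (\<lambda>x. g m x - h n x)) \<longlonglongrightarrow> 0"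
  proof (rule L2_norm_dominated_convergence)
    show "(\<lambda>x. complex_of_real (2 * k * indicator {-(k+1)..k+1} x)) \<in> L2_space"
      using k by (intro L2_space_bounded_supportI[where C = "2*k" and R = "k+1"])
        (auto simp: indicator_def)
    show "AE x in lborel. (\<lambda>m. g m x) \<longlonglongrightarrow> h n x"
      using AE_N
    proof eventually_elim
      case (elim x)
      have "isCont (clip k) (f x)"
        using continuous_on_clip by (simp add: continuous_on_eq_continuous_at)
      from isCont_tendsto_compose[OF this lim[OF elim]]
      show ?case unfolding g_def h_def k_def by (intro tendsto_intros)
    qed
    show "AE x in lborel. cmod (g m x - h n x)
        \<le> cmod (complex_of_real (2 * k * indicator {-(k+1)..k+1} x))" for m
    proof (intro always_eventually allI)
      fix x
      have "cmod (h n x) \<le> k"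
        unfolding h_def k_def by (rule cutoff_clip_norm_le) simp
      then have 1: "cmod (g m x - h n x) \<le> 2 * k"
        using norm_triangle_ineq4[of "g m x" "h n x"] g_le[of m x] by linarith
      have 2: "g m x - h n x = 0" if "k + 1 < \<bar>x\<bar>"
        using that by (simp add: g_def h_def k_def cutoff_eq_0)
      show "cmod (g m x - h n x) \<le> cmod (complex_of_real (2 * k * indicator {-(k+1)..k+1} x))"
        using 1 2 k by (cases "k + 1 < \<bar>x\<bar>") (auto simp: indicator_def norm_mult)
    qed
  qed simp_all
  then have "\<forall>\<^sub>F m in sequentially. L2_norm (\<lambda>x. g m x - h n x) < e / 2"
    by (rule order_tendstoD) (use e in simp)
  then obtain m where m: "L2_norm (\<lambda>x. g m x - h n x) < e / 2"
    by (auto simp: eventually_sequentially)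
  have "L2_norm (\<lambda>x. f x - g m x) \<le> L2_norm (\<lambda>x. f x - h n x) + L2_norm (\<lambda>x. h n x - g m x)"
    by (rule L2_norm_diff_triangle[OF f h_L2 g_L2])
  also have "\<dots> < e"
    using n m L2_norm_minus_commute[of f "h n"] L2_norm_minus_commute[of "h n" "g m"] by simp
  finally show ?thesis
    using that[OF g_cont] g_supp g_le by blast
qed

lemma L2_space_translate: "f \<in> L2_space \<Longrightarrow> (\<lambda>x. f (x - z)) \<in> L2_space"
  using lborel_integrable_real_affine[of "\<lambda>x. (cmod (f x))\<^sup>2" 1 "-z"]
  by (auto simp: L2_space_def)

lemma L2_norm_translate: "L2_norm (\<lambda>x. f (x - z)) = L2_norm f"
  using lborel_integral_real_affine[of 1 "\<lambda>x. (cmod (f x))\<^sup>2" "-z"]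
  by (simp add: L2_norm_def)

text \<open>For continuous \<open>g\<close> of compact support this is dominated convergence. The
  general case is a three-term estimate, since translation preserves the L^2 norm and with it the
  error of approximating \<open>f\<close> by \<open>g\<close>.\<close>

lemma L2_translate_tendsto:
  fixes X :: "nat \<Rightarrow> real"
  assumes f: "f \<in> L2_space" and X: "X \<longlonglongrightarrow> 0"
  shows "(\<lambda>n. L2_norm (\<lambda>x. f (x - X n) - f x)) \<longlonglongrightarrow> 0"
proof (rule LIMSEQ_I)
  fix r :: real assume "0 < r"
  then have r: "0 < r / 3" by simp
  obtain g R C where g_approx: "continuous_on UNIV g" "\<forall>x. R < \<bar>x\<bar> \<longrightarrow> g x = 0"
    "\<forall>x. cmod (g x) \<le> C" and gr: "L2_norm (\<lambda>x. f x - g x) < r / 3"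
    by (rule L2_approx_continuous[OF f r])
  note g = g_approx(1) g_approx(2,3)[rule_format]
  have C: "0 \<le> C" using g(3)[of 0] norm_ge_zero order_trans by blast
  have [measurable]: "g \<in> borel_measurable borel"
    using g(1) by (rule borel_measurable_continuous_onI)
  have gL2: "g \<in> L2_space"
    by (rule L2_space_bounded_supportI[OF _ g(3) g(2)]) auto
  \<comment> \<open>A common bound on the shifts puts the supports of all translates of
    \<open>g\<close> into \<open>[-(R + B), R + B]\<close>, so one majorant serves every
    \<open>n\<close>.\<close>
  obtain B where B: "\<And>n. \<bar>X n\<bar> \<le> B"
    using X convergent_imp_Bseq[of X] unfolding convergent_def Bseq_def by auto
  have "(\<lambda>n. L2_norm (\<lambda>x. g (x - X n) - g x)) \<longlonglongrightarrow> 0"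
  proof (rule L2_norm_dominated_convergence)
    show "(\<lambda>x. complex_of_real (2 * C * indicator {-(R+B)..R+B} x)) \<in> L2_space"
      using C by (intro L2_space_bounded_supportI[where C = "2*C" and R = "R+B"])
        (auto simp: indicator_def)
    have "(\<lambda>n. g (x - X n)) \<longlonglongrightarrow> g x" for x
    proof -
      have "(\<lambda>n. x - X n) \<longlonglongrightarrow> x - 0" by (intro tendsto_intros X)
      then show ?thesis
        using g(1) by (intro isCont_tendsto_compose[of x g])
          (auto simp: continuous_on_eq_continuous_at)
    qed
    then show "AE x in lborel. (\<lambda>n. g (x - X n)) \<longlonglongrightarrow> g x" by simp
    show "AE x in lborel. cmod (g (x - X n) - g x)
        \<le> cmod (complex_of_real (2 * C * indicator {-(R+B)..R+B} x))" for n
    proof (intro always_eventually allI)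
      fix x
      have 1: "cmod (g (x - X n) - g x) \<le> 2 * C"
        using norm_triangle_ineq4[of "g (x - X n)" "g x"] g(3)[of x] g(3)[of "x - X n"] by linarith
      have 2: "g (x - X n) - g x = 0" if "R + B < \<bar>x\<bar>"
        using that B[of n] g(2)[of x] g(2)[of "x - X n"] by (auto simp: abs_if split: if_splits)
      show "cmod (g (x - X n) - g x) \<le> cmod (complex_of_real (2 * C * indicator {-(R+B)..R+B} x))"
        using 1 2 C by (cases "R + B < \<bar>x\<bar>") (auto simp: indicator_def norm_mult)
    qed
  qed simp_all
  then have "\<forall>\<^sub>F n in sequentially. L2_norm (\<lambda>x. g (x - X n) - g x) < r / 3"
    using r by (rule order_tendstoD)
  then obtain n0 where n0: "\<And>n. n \<ge> n0 \<Longrightarrow> L2_norm (\<lambda>x. g (x - X n) - g x) < r / 3"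
    unfolding eventually_sequentially by blast
  have "L2_norm (\<lambda>x. f (x - X n) - f x) < r" if "n \<ge> n0" for n
  proof -
    note T = L2_space_translate[of _ "X n"]
    have "L2_norm (\<lambda>x. f (x - X n) - f x)
        \<le> L2_norm (\<lambda>x. f (x - X n) - g (x - X n)) + L2_norm (\<lambda>x. g (x - X n) - f x)"
      by (rule L2_norm_diff_triangle[OF T[OF f] T[OF gL2] f])
    also have "L2_norm (\<lambda>x. g (x - X n) - f x)
        \<le> L2_norm (\<lambda>x. g (x - X n) - g x) + L2_norm (\<lambda>x. g x - f x)"
      by (rule L2_norm_diff_triangle[OF T[OF gL2] gL2 f])
    also have "L2_norm (\<lambda>x. f (x - X n) - g (x - X n)) = L2_norm (\<lambda>x. f x - g x)"
      by (rule L2_norm_translate)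
    finally show ?thesis
      using gr n0[OF that] L2_norm_minus_commute[of f g] by linarith
  qed
  then show "\<exists>n0. \<forall>n\<ge>n0. norm (L2_norm (\<lambda>x. f (x - X n) - f x) - 0) < r"
    by auto
qed

text \<open>For \<open>f\<close> in both L^1 and L^2 its Fourier transform is |F f|^2, and its value
  at 0 is the squared L^2 norm. Plancherel's identity is thus Fourier inversion at the single point
  0, for which continuity at 0 suffices.\<close>

definition autocorrelation :: "(real \<Rightarrow> complex) \<Rightarrow> real \<Rightarrow> complex" where
  "autocorrelation f z = (LINT x|lborel. f x * cnj (f (x - z)))"

lemma L2_space_cnj: "f \<in> L2_space \<Longrightarrow> (\<lambda>x. cnj (f x)) \<in> L2_space"
  by (rule L2_space_bound[of f _ 1])
    (auto intro: borel_measurable_continuous_on[OF continuous_on_cnj[OF continuous_on_id]])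

lemma norm_integral_mult_le_L2:
  assumes "f \<in> L2_space" "g \<in> L2_space"
  shows "cmod (LINT x|lborel. f x * g x) \<le> L2_norm f * L2_norm g"
proof -
  have "cmod (LINT x|lborel. f x * g x) \<le> (LINT x|lborel. cmod (f x * g x))"
    by (rule integral_norm_bound)
  with L2_Cauchy_Schwarz[OF assms] show ?thesis by (simp add: norm_mult)
qed

lemma norm_autocorrelation_le:
  assumes f: "f \<in> L2_space"
  shows "cmod (autocorrelation f z) \<le> (L2_norm f)\<^sup>2"
  using norm_integral_mult_le_L2[OF f L2_space_cnj[OF L2_space_translate[OF f, of z]]]
    L2_norm_translate[of f z]
  by (simp add: autocorrelation_def power2_eq_square L2_norm_def)

text \<open>The error is an inner product of \<open>f\<close> with the difference of a translate of
  \<open>f\<close> and \<open>f\<close>, so Cauchy-Schwarz reduces it to continuity of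
  translations.\<close>

lemma autocorrelation_tendsto:
  fixes X :: "nat \<Rightarrow> real"
  assumes f: "f \<in> L2_space" and X: "X \<longlonglongrightarrow> 0"
  shows "(\<lambda>n. autocorrelation f (X n)) \<longlonglongrightarrow> complex_of_real ((L2_norm f)\<^sup>2)"
proof -
  have "autocorrelation f (X n) - complex_of_real ((L2_norm f)\<^sup>2)
      = (LINT x|lborel. f x * cnj (f (x - X n) - f x))" for n
  proof -
    have "complex_of_real ((L2_norm f)\<^sup>2) = (LINT x|lborel. f x * cnj (f x))"
      unfolding L2_norm_power2 integral_complex_of_real[symmetric] complex_norm_square ..
    then show ?thesis
      unfolding autocorrelation_def
      by (simp add: right_diff_distrib Bochner_Integration.integral_diff[OF
            integrable_mult_L2[OF f L2_space_cnj[OF L2_space_translate[OF f]]]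
            integrable_mult_L2[OF f L2_space_cnj[OF f]]])
  qed
  moreover have "(\<lambda>n. LINT x|lborel. f x * cnj (f (x - X n) - f x)) \<longlonglongrightarrow> 0"
  proof (rule Lim_null_comparison)
    have "cmod (LINT x|lborel. f x * cnj (f (x - X n) - f x))
        \<le> L2_norm f * L2_norm (\<lambda>x. f (x - X n) - f x)" for n
      using norm_integral_mult_le_L2[OF f L2_space_cnj[OF L2_space_diff[OF L2_space_translate[OF f, of "X n"] f]]]
      by (simp add: L2_norm_def flip: complex_cnj_diff)
    then show "\<forall>\<^sub>F n in sequentially. cmod (LINT x|lborel. f x * cnj (f (x - X n) - f x))
        \<le> L2_norm f * L2_norm (\<lambda>x. f (x - X n) - f x)" by simp
    show "(\<lambda>n. L2_norm f * L2_norm (\<lambda>x. f (x - X n) - f x)) \<longlonglongrightarrow> 0"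
      using tendsto_mult_right_zero[OF L2_translate_tendsto[OF f X]] .
  qed
  ultimately have "(\<lambda>n. autocorrelation f (X n) - complex_of_real ((L2_norm f)\<^sup>2)) \<longlonglongrightarrow> 0"
    by presburger
  then show ?thesis by (rule LIM_zero_cancel)
qed

subsection \<open>The Plancherel theorem\<close>

lemma cnj_measurable [measurable]: "cnj \<in> borel_measurable borel"
  by (intro borel_measurable_continuous_onI continuous_intros)

lemma pair_sigma_finite_lborel:
  assumes "finite_measure N" shows "pair_sigma_finite N (lborel :: real measure)"
  using assms finite_measure.axioms(1) sigma_finite_lborel by (blast intro: pair_sigma_finite.intro)

text \<open>The Gaussian weight makes the frequency measure finite. A bounded kernel, such as the
  Fourier exponential, is then integrable against \<open>f\<close> on the product.\<close>

lemma Fubini_bounded_kernel: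
  fixes k :: "'a \<Rightarrow> real \<Rightarrow> complex" and f :: "real \<Rightarrow> complex"
  assumes "finite_measure N" and f: "integrable lborel f"
    and k [measurable]: "case_prod k \<in> borel_measurable (N \<Otimes>\<^sub>M lborel)"
    and C: "\<And>\<eta> x. cmod (k \<eta> x) \<le> C"
  shows "(LINT \<eta>|N. LINT x|lborel. k \<eta> x * f x) = (LINT x|lborel. (LINT \<eta>|N. k \<eta> x) * f x)"
proof -
  note N_pair = pair_sigma_finite_lborel[OF assms(1)]
  have [measurable]: "f \<in> borel_measurable lborel"
    using f by simp
  have k_meas [measurable]: "k \<eta> \<in> borel_measurable lborel" if "\<eta> \<in> space N" for \<eta>
    using measurable_compose[OF measurable_Pair1'[OF that] k] by simp
  have int: "integrable lborel (\<lambda>x. k \<eta> x * f x)" if "\<eta> \<in> space N" for \<eta>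
  proof (rule Bochner_Integration.integrable_bound[OF integrable_mult_right[OF f, of "complex_of_real C"]])
    have "0 \<le> C" using C norm_ge_zero order_trans by blast
    then show "AE x in lborel. norm (k \<eta> x * f x) \<le> norm (complex_of_real C * f x)"
      using C by (intro always_eventually allI) (simp add: norm_mult mult_right_mono)
  qed (use k_meas[OF that] in measurable)
  have "integrable (N \<Otimes>\<^sub>M lborel) (\<lambda>(\<eta>, x). k \<eta> x * f x)"
  proof (rule pair_sigma_finite.Fubini_integrable[OF N_pair])
    show "integrable N (\<lambda>\<eta>. LINT x|lborel. cmod (case (\<eta>, x) of (\<eta>, x) \<Rightarrow> k \<eta> x * f x))"
    proof (rule finite_measure.integrable_const_bound[OF assms(1), where B = "C * (LINT x|lborel. cmod (f x))"])
      have "(LINT x|lborel. cmod (k \<eta> x * f x)) \<le> C * (LINT x|lborel. cmod (f x))"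
        if "\<eta> \<in> space N" for \<eta>
      proof -
        have "(LINT x|lborel. cmod (k \<eta> x * f x)) \<le> (LINT x|lborel. C * cmod (f x))"
          using integrable_norm[OF int[OF that]] f C
          by (intro integral_mono) (auto simp: norm_mult mult_right_mono)
        then show ?thesis using f by simp
      qed
      then show "AE \<eta> in N. norm (LINT x|lborel. cmod (case (\<eta>, x) of (\<eta>, x) \<Rightarrow> k \<eta> x * f x))
          \<le> C * (LINT x|lborel. cmod (f x))"
        by (intro AE_I2) simp
    qed measurable
    show "AE \<eta> in N. integrable lborel (\<lambda>x. case (\<eta>, x) of (\<eta>, x) \<Rightarrow> k \<eta> x * f x)"
      using int by (intro AE_I2) simp
  qed measurable
  from pair_sigma_finite.Fubini_integral[OF N_pair this] show ?thesis
    by simp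
qed

lemma fourier_L1_measurable [measurable]:
  assumes [measurable]: "f \<in> borel_measurable borel"
  shows "fourier_L1 f \<in> borel_measurable borel"
  unfolding fourier_L1_def by measurable

lemma norm_fourier_L1_le: "cmod (fourier_L1 f \<xi>) \<le> L1_norm f"
proof -
  have "cmod (fourier_L1 f \<xi>) \<le> (LINT x|lborel. cmod (exp (- (\<i> * complex_of_real (x * \<xi>))) * f x))"
    unfolding fourier_L1_def by (rule integral_norm_bound)
  also have "\<dots> = L1_norm f"
    by (simp add: L1_norm_def norm_mult norm_exp_eq_Re)
  finally show ?thesis .
qed

abbreviation std_normal :: "real measure" where
  "std_normal \<equiv> density lborel (\<lambda>x. ennreal (std_normal_density x))"

lemma finite_measure_std_normal: "finite_measure std_normal"
  using prob_space_normal_density[of 1 0] by (simp add: prob_space.finite_measure)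

text \<open>The Gaussian average of \<open>|F f|\<^sup>2\<close> over scale \<open>1/e\<close>: expand both factors, do the frequency
  integral with the characteristic function of the normal law, and substitute \<open>y = x - e z\<close>.\<close>

lemma gaussian_fourier_autocorrelation:
  assumes f1: "integrable lborel f" and f2: "f \<in> L2_space" and e: "0 < e"
  shows "(LINT \<eta>|std_normal. complex_of_real ((cmod (fourier_L1 f (\<eta> / e)))\<^sup>2))
    = complex_of_real (e * sqrt (2 * pi)) * (LINT z|std_normal. autocorrelation f (e * z))"
proof -
  note [measurable] = L2_space_measurable[OF f2]
  note N_pair = pair_sigma_finite_lborel[OF finite_measure_std_normal]
  define E where "E = (\<lambda>s::real. exp (- (\<i> * complex_of_real s)))"
  have E_meas [measurable]: "E \<in> borel_measurable borel"
    unfolding E_def by measurable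
  have norm_E [simp]: "cmod (E s) = 1" for s
    by (simp add: E_def norm_exp_eq_Re)
  have E_cnj: "cnj (E s) = E (- s)" for s
    by (simp add: E_def exp_cnj)
  have E_mult: "E s * E t = E (s + t)" for s t
    by (simp add: E_def exp_add[symmetric] algebra_simps)
  let ?F = "fourier_L1 f"
  have F_def: "?F \<xi> = (LINT x|lborel. E (x * \<xi>) * f x)" for \<xi>
    by (simp add: fourier_L1_def E_def)
  have cnj_F: "cnj (?F \<xi>) = (LINT y|lborel. E (- (y * \<xi>)) * cnj (f y))" for \<xi>
  proof -
    have "cnj (?F \<xi>) = (LINT y|lborel. cnj (E (y * \<xi>) * f y))"
      unfolding F_def by (rule Bochner_Integration.integral_cnj[symmetric])
    then show ?thesis by (simp only: complex_cnj_mult E_cnj)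
  qed
  have f1c: "integrable lborel (\<lambda>y. cnj (f y))"
    using f1 by simp
  \<comment> \<open>The characteristic function is taken at \<open>- s\<close> because
    \<open>E\<close> carries the sign of the Fourier kernel, opposite to that of
    \<open>char\<close>.\<close>
  have gauss: "(LINT \<eta>|std_normal. E (s * \<eta>)) = complex_of_real (exp (- s\<^sup>2 / 2))" for s
  proof -
    have "char std_normal (- s) = complex_of_real (exp (- (- s)\<^sup>2 / 2))"
      using char_std_normal_distribution by metis
    then show ?thesis
      by (simp add: char_def E_def mult_ac)
  qed
  have "(LINT \<eta>|std_normal. complex_of_real ((cmod (?F (\<eta> / e)))\<^sup>2))
      = (LINT \<eta>|std_normal. LINT x|lborel. E (x * (\<eta> / e)) * cnj (?F (\<eta> / e)) * f x)"
  proof (rule Bochner_Integration.integral_cong[OF refl])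
    fix \<eta>
    have "complex_of_real ((cmod (?F (\<eta> / e)))\<^sup>2) = (LINT x|lborel. E (x * (\<eta> / e)) * f x) * cnj (?F (\<eta> / e))"
      unfolding complex_norm_square F_def[of "\<eta> / e", symmetric] ..
    also have "\<dots> = (LINT x|lborel. E (x * (\<eta> / e)) * f x * cnj (?F (\<eta> / e)))"
      by (rule integral_mult_left_zero[symmetric])
    finally show "complex_of_real ((cmod (?F (\<eta> / e)))\<^sup>2)
        = (LINT x|lborel. E (x * (\<eta> / e)) * cnj (?F (\<eta> / e)) * f x)"
      by (simp add: mult_ac)
  qed
  \<comment> \<open>The conjugate factor counts as part of the kernel, bounded by
    \<open>L1_norm f\<close>. In this way each use of Fubini integrates only one copy of
    \<open>f\<close>.\<close>
  also have "\<dots> = (LINT x|lborel. (LINT \<eta>|std_normal. E (x * (\<eta> / e)) * cnj (?F (\<eta> / e))) * f x)"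
    using norm_fourier_L1_le[of f]
    by (intro Fubini_bounded_kernel[OF finite_measure_std_normal f1, where C = "L1_norm f"])
       (auto simp: norm_mult)
  also have "\<dots> = (LINT x|lborel. complex_of_real (e * sqrt (2 * pi)) *
      (LINT z|std_normal. f x * cnj (f (x - e * z))))"
  proof (rule Bochner_Integration.integral_cong[OF refl])
    fix x
    have "(LINT \<eta>|std_normal. E (x * (\<eta> / e)) * cnj (?F (\<eta> / e)))
        = (LINT \<eta>|std_normal. LINT y|lborel. E ((x - y) / e * \<eta>) * cnj (f y))"
    proof -
      have "E (x * (\<eta> / e)) * (E (- (y * (\<eta> / e))) * c) = E ((x - y) / e * \<eta>) * c" for \<eta> y c
      proof -
        have "x * (\<eta> / e) + - (y * (\<eta> / e)) = (x - y) / e * \<eta>"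
          by (simp add: diff_divide_distrib left_diff_distrib)
        then show ?thesis
          by (simp only: mult.assoc[symmetric] E_mult)
      qed
      then show ?thesis
        unfolding cnj_F integral_mult_right_zero[symmetric] by presburger
    qed
    also have "\<dots> = (LINT y|lborel. (LINT \<eta>|std_normal. E ((x - y) / e * \<eta>)) * cnj (f y))"
      by (intro Fubini_bounded_kernel[OF finite_measure_std_normal f1c, where C = 1]) auto
    also have "\<dots> = \<bar>- e\<bar> *\<^sub>R (LINT z|lborel.
        (LINT \<eta>|std_normal. E ((x - (x + (- e) * z)) / e * \<eta>)) * cnj (f (x + (- e) * z)))"
      using e by (intro lborel_integral_real_affine) simp
    also have "\<dots> = e *\<^sub>R (LINT z|lborel. complex_of_real (exp (- z\<^sup>2 / 2)) * cnj (f (x - e * z)))"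
      unfolding gauss using e by simp
    also have "\<dots> = complex_of_real (e * sqrt (2 * pi)) *
        (LINT z|lborel. std_normal_density z *\<^sub>R cnj (f (x - e * z)))"
      unfolding integral_mult_right_zero[symmetric] integral_scaleR_right[symmetric]
      by (intro Bochner_Integration.integral_cong refl)
        (simp add: std_normal_density_def scaleR_conv_of_real field_simps)
    also have "\<dots> = complex_of_real (e * sqrt (2 * pi)) *
        (LINT z|std_normal. cnj (f (x - e * z)))"
      by (subst integral_density) auto
    finally show "(LINT \<eta>|std_normal. E (x * (\<eta> / e)) * cnj (?F (\<eta> / e))) * f x
        = complex_of_real (e * sqrt (2 * pi)) * (LINT z|std_normal. f x * cnj (f (x - e * z)))"
      by (simp add: mult_ac)
  qed
  also have "\<dots> = complex_of_real (e * sqrt (2 * pi)) *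
      (LINT x|lborel. LINT z|std_normal. f x * cnj (f (x - e * z)))"
    by simp
  \<comment> \<open>Here \<open>f\<close> in L^2 enters: by Cauchy-Schwarz and translation
    invariance the inner integral over \<open>x\<close> is at most
    \<open>(L2_norm f)\<^sup>2\<close>, uniformly in \<open>z\<close>.\<close>
  also have "(LINT x|lborel. LINT z|std_normal. f x * cnj (f (x - e * z)))
      = (LINT z|std_normal. LINT x|lborel. f x * cnj (f (x - e * z)))"
  proof (rule pair_sigma_finite.Fubini_integral[OF N_pair, of "\<lambda>z x. f x * cnj (f (x - e * z))"],
      rule pair_sigma_finite.Fubini_integrable[OF N_pair])
    have tr: "(\<lambda>x. cnj (f (x - e * z))) \<in> L2_space" for z
      by (intro L2_space_cnj L2_space_translate f2)
    have "(LINT x|lborel. cmod (f x) * cmod (f (x - e * z))) \<le> (L2_norm f)\<^sup>2" for z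
      using L2_Cauchy_Schwarz[OF f2 L2_space_translate[OF f2, of "e * z"]] L2_norm_translate[of f "e * z"]
      by (simp add: power2_eq_square)
    then show "integrable std_normal
        (\<lambda>z. LINT x|lborel. cmod (case (z, x) of (z, x) \<Rightarrow> f x * cnj (f (x - e * z))))"
      by (intro finite_measure.integrable_const_bound[OF finite_measure_std_normal, where B = "(L2_norm f)\<^sup>2"]) (auto simp: norm_mult)
    show "AE z in std_normal. integrable lborel
        (\<lambda>x. case (z, x) of (z, x) \<Rightarrow> f x * cnj (f (x - e * z)))"
      using integrable_mult_L2[OF f2 tr] by (intro AE_I2) simp
  qed measurable
  finally show ?thesis
    by (simp add: autocorrelation_def)
qed

text \<open>The substitution \<open>\<eta> = e \<xi>\<close> moves the scale from the transform into
  the weight, which becomes flat as \<open>e\<close> tends to 0. The Jacobian cancels the factor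
  \<open>e\<close> on the other side.\<close>

lemma gaussian_fourier_L2:
  assumes f1: "integrable lborel f" and f2: "f \<in> L2_space" and e: "0 < e"
  shows "integrable lborel (\<lambda>\<xi>. std_normal_density (e * \<xi>) * (cmod (fourier_L1 f \<xi>))\<^sup>2)" (is ?int)
    and "complex_of_real (LINT \<xi>|lborel. std_normal_density (e * \<xi>) * (cmod (fourier_L1 f \<xi>))\<^sup>2)
      = complex_of_real (sqrt (2 * pi)) * (LINT z|std_normal. autocorrelation f (e * z))" (is ?eq)
proof -
  note [measurable] = L2_space_measurable[OF f2]
  let ?F = "fourier_L1 f"
  have "integrable std_normal (\<lambda>\<eta>. (cmod (?F (\<eta> / e)))\<^sup>2)"
    using norm_fourier_L1_le[of f]
    by (intro finite_measure.integrable_const_bound[OF finite_measure_std_normal, where B = "(L1_norm f)\<^sup>2"]) (auto intro!: always_eventually power_mono)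
  then have "integrable lborel (\<lambda>\<eta>. std_normal_density \<eta> * (cmod (?F (\<eta> / e)))\<^sup>2)"
    by (subst (asm) integrable_density) auto
  from lborel_integrable_real_affine[OF this, of e 0] show ?int
    using e by simp
  have "(LINT \<eta>|std_normal. complex_of_real ((cmod (?F (\<eta> / e)))\<^sup>2))
      = complex_of_real (LINT \<eta>|std_normal. (cmod (?F (\<eta> / e)))\<^sup>2)"
    by (rule integral_complex_of_real)
  also have "(LINT \<eta>|std_normal. (cmod (?F (\<eta> / e)))\<^sup>2)
      = (LINT \<eta>|lborel. std_normal_density \<eta> * (cmod (?F (\<eta> / e)))\<^sup>2)"
    by (subst integral_density) auto
  also have "\<dots> = e * (LINT \<xi>|lborel. std_normal_density (e * \<xi>) * (cmod (?F \<xi>))\<^sup>2)"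
    using e by (subst lborel_integral_real_affine[of e _ 0]) auto
  finally show ?eq
    using gaussian_fourier_autocorrelation[OF f1 f2 e] e by (simp add: mult.assoc)
qed

text \<open>Let \<open>e\<close> tend to 0 in the damped identity. The averages of the
  autocorrelation tend to its value at 0, and the weight tends to \<open>1 / sqrt (2 * pi)\<close>;
  with the factor \<open>sqrt (2 * pi)\<close> on the other side this gives \<open>2 * pi\<close>
  for the squared norms.\<close>

lemma Plancherel_L1_L2:
  assumes f1: "integrable lborel f" and f2: "f \<in> L2_space"
  shows "fourier_L1 f \<in> L2_space" (is ?mem) and "L2_norm (fourier_L1 f) = sqrt (2 * pi) * L2_norm f"
proof -
  note [measurable] = L2_space_measurable[OF f2]
  have N_prob: "measure std_normal UNIV = 1"
    using prob_space.prob_space[OF prob_space_normal_density[of 1 0]] by simp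
  let ?F = "fourier_L1 f"
  define X where "X = (\<lambda>n. inverse (real (Suc n)))"
  have X: "X \<longlonglongrightarrow> 0" "\<And>n. 0 < X n"
    unfolding X_def by (rule LIMSEQ_inverse_real_of_nat) simp
  have X_le1: "X n \<le> 1" for n by (simp add: X_def field_simps)
  have X_anti: "X m \<le> X n" if "n \<le> m" for m n
    using that by (simp add: X_def field_simps)
  let ?g = "\<lambda>n \<xi>. std_normal_density (X n * \<xi>) * (cmod (?F \<xi>))\<^sup>2"
  have "(\<lambda>n. LINT z|std_normal. autocorrelation f (X n * z))
      \<longlonglongrightarrow> (LINT z|std_normal. complex_of_real ((L2_norm f)\<^sup>2))"
  proof (rule integral_dominated_convergence[where w = "\<lambda>_. (L2_norm f)\<^sup>2"])
    show "(\<lambda>z. autocorrelation f (X n * z)) \<in> borel_measurable std_normal" for n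
      unfolding autocorrelation_def by measurable
    have "(\<lambda>n. autocorrelation f (X n * z)) \<longlonglongrightarrow> complex_of_real ((L2_norm f)\<^sup>2)" for z
      using autocorrelation_tendsto[OF f2 tendsto_mult_left_zero[OF X(1)]] .
    then show "AE z in std_normal. (\<lambda>n. autocorrelation f (X n * z))
        \<longlonglongrightarrow> complex_of_real ((L2_norm f)\<^sup>2)" by simp
    show "AE z in std_normal. norm (autocorrelation f (X n * z)) \<le> (L2_norm f)\<^sup>2" for n
      using norm_autocorrelation_le[OF f2] by simp
  qed (simp_all add: finite_measure.integrable_const[OF finite_measure_std_normal])
  also have "(LINT z|std_normal. complex_of_real ((L2_norm f)\<^sup>2)) = complex_of_real ((L2_norm f)\<^sup>2)"
    by (simp add: N_prob)
  finally have "(\<lambda>n. complex_of_real (sqrt (2 * pi)) * (LINT z|std_normal. autocorrelation f (X n * z)))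
      \<longlonglongrightarrow> complex_of_real (sqrt (2 * pi)) * complex_of_real ((L2_norm f)\<^sup>2)"
    by (intro tendsto_intros)
  then have lim: "(\<lambda>n. LINT \<xi>|lborel. ?g n \<xi>) \<longlonglongrightarrow> sqrt (2 * pi) * (L2_norm f)\<^sup>2"
    unfolding gaussian_fourier_L2(2)[OF f1 f2 X(2), symmetric] of_real_mult[symmetric]
    by (simp only: tendsto_of_real_iff)
  \<comment> \<open>Monotone convergence also delivers integrability of the limit, that is,
    square-integrability of the transform. The weights increase because \<open>X\<close>
    decreases.\<close>
  have hbi: "has_bochner_integral lborel (\<lambda>\<xi>. 1 / sqrt (2 * pi) * (cmod (?F \<xi>))\<^sup>2)
      (sqrt (2 * pi) * (L2_norm f)\<^sup>2)"
  proof (rule has_bochner_integral_monotone_convergence[OF _ _ _ lim])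
    show "integrable lborel (?g n)" for n
      by (rule gaussian_fourier_L2(1)[OF f1 f2 X(2)])
    have "mono (\<lambda>n. ?g n \<xi>)" for \<xi>
    proof (rule monoI)
      fix m n :: nat assume "m \<le> n"
      then have "(X n)\<^sup>2 \<le> (X m)\<^sup>2"
        using X_anti X(2)[of n] by (intro power_mono) auto
      then have "(X n * \<xi>)\<^sup>2 \<le> (X m * \<xi>)\<^sup>2"
        by (simp add: power_mult_distrib mult_right_mono)
      then show "?g m \<xi> \<le> ?g n \<xi>"
        by (intro mult_right_mono) (auto simp: std_normal_density_def divide_right_mono)
    qed
    then show "AE \<xi> in lborel. mono (\<lambda>n. ?g n \<xi>)" by simp
    have "(\<lambda>n. ?g n \<xi>) \<longlonglongrightarrow> 1 / sqrt (2 * pi) * exp (- (0 * \<xi>)\<^sup>2 / 2) * (cmod (?F \<xi>))\<^sup>2" for \<xi>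
      unfolding std_normal_density_def by (intro tendsto_intros X) simp
    then show "AE \<xi> in lborel. (\<lambda>n. ?g n \<xi>) \<longlonglongrightarrow> 1 / sqrt (2 * pi) * (cmod (?F \<xi>))\<^sup>2"
      by simp
  qed measurable
  from has_bochner_integral_mult_right[of "sqrt (2 * pi)", OF this]
  have hbi: "has_bochner_integral lborel (\<lambda>\<xi>. (cmod (?F \<xi>))\<^sup>2) (2 * pi * (L2_norm f)\<^sup>2)"
    by (simp add: mult.assoc[symmetric])
  then show ?mem
    by (simp add: L2_space_def has_bochner_integral_iff)
  have "(L2_norm ?F)\<^sup>2 = (sqrt (2 * pi) * L2_norm f)\<^sup>2"
    using hbi by (simp add: L2_norm_power2 has_bochner_integral_iff power_mult_distrib)
  then show "L2_norm ?F = sqrt (2 * pi) * L2_norm f"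
    by (rule power2_eq_imp_eq) simp_all
qed

section \<open>The Fourier-Plancherel transform on L^2\<close>

abbreviation truncate :: "real \<Rightarrow> (real \<Rightarrow> complex) \<Rightarrow> real \<Rightarrow> complex" where
  "truncate R f \<equiv> (\<lambda>x. indicator {-R..R} x * f x)"

lemma L2_space_truncate: "f \<in> L2_space \<Longrightarrow> truncate R f \<in> L2_space"
  by (rule L2_space_mult_bounded[where C = 1]) (auto simp: indicator_def)

lemma integrable_truncate:
  assumes "f \<in> L2_space" shows "integrable lborel (truncate R f)"
proof (rule integrable_mult_L2[OF _ assms])
  show "indicator {-R..R} \<in> L2_space"
    by (rule L2_space_bounded_supportI[where C = 1 and R = R]) (auto simp: indicator_def)
qed

lemma truncate_tendsto: "(\<lambda>n. truncate (real n) f x) \<longlonglongrightarrow> f x"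
proof (rule tendsto_eventually)
  have "\<forall>\<^sub>F n in sequentially. \<bar>x\<bar> < real n"
    by (rule filterlim_at_top_dense[THEN iffD1, rule_format, OF filterlim_real_sequentially])
  then show "\<forall>\<^sub>F n in sequentially. truncate (real n) f x = f x"
    by eventually_elim (auto simp: indicator_def)
qed

lemma L2_norm_truncate_tendsto:
  assumes f: "f \<in> L2_space"
  shows "(\<lambda>n. L2_norm (truncate (real n) f)) \<longlonglongrightarrow> L2_norm f"
proof -
  note [measurable] = f[THEN L2_space_measurable]
  have "(\<lambda>n. L2_norm (\<lambda>x. truncate (real n) f x - f x)) \<longlonglongrightarrow> 0"
  proof (rule L2_norm_dominated_convergence[OF _ _ f])
    show "AE x in lborel. (\<lambda>n. truncate (real n) f x) \<longlonglongrightarrow> f x"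
      using truncate_tendsto by simp
    show "AE x in lborel. cmod (truncate (real n) f x - f x) \<le> cmod (f x)" for n
      by (auto simp: indicator_def)
  qed simp_all
  then have "(\<lambda>n. L2_norm (truncate (real n) f) - L2_norm f) \<longlonglongrightarrow> 0"
    by (rule Lim_null_comparison[rotated])
      (use L2_norm_reverse_triangle[OF L2_space_truncate[OF f] f] in simp)
  then show ?thesis by (rule LIM_zero_cancel)
qed

lemma fourier_L1_truncate_L2: "f \<in> L2_space \<Longrightarrow> fourier_L1 (truncate R f) \<in> L2_space"
  by (rule Plancherel_L1_L2(1)[OF integrable_truncate L2_space_truncate])

lemma integrable_fourier_kernel:
  assumes "integrable lborel f"
  shows "integrable lborel (\<lambda>x. exp (- (\<i> * complex_of_real (x * \<xi>))) * f x)"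
  by (rule Bochner_Integration.integrable_bound[OF assms])
    (use assms in \<open>auto simp: norm_mult norm_exp_eq_Re\<close>)

lemma fourier_L1_add:
  assumes "integrable lborel f" "integrable lborel g"
  shows "fourier_L1 (\<lambda>x. f x + g x) \<xi> = fourier_L1 f \<xi> + fourier_L1 g \<xi>"
  unfolding fourier_L1_def distrib_left
  by (rule Bochner_Integration.integral_add; rule integrable_fourier_kernel; fact)

lemma fourier_L1_cmult: "fourier_L1 (\<lambda>x. c * f x) \<xi> = c * fourier_L1 f \<xi>"
  unfolding fourier_L1_def by (simp add: mult.left_commute)

lemma has_fourier_L2_add:
  assumes f: "has_fourier_L2 f f'" and g: "has_fourier_L2 g g'"
  shows "has_fourier_L2 (\<lambda>x. f x + g x) (\<lambda>\<xi>. f' \<xi> + g' \<xi>)"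
proof -
  have L2: "f \<in> L2_space" "f' \<in> L2_space" "g \<in> L2_space" "g' \<in> L2_space"
    using f g by (auto simp: has_fourier_L2_def)
  have eq: "fourier_L1 (truncate R (\<lambda>x. f x + g x)) \<xi>
      = fourier_L1 (truncate R f) \<xi> + fourier_L1 (truncate R g) \<xi>" for R \<xi>
    using fourier_L1_add[OF integrable_truncate[OF L2(1)] integrable_truncate[OF L2(3)], of R R \<xi>]
    by (simp add: distrib_left)
  have "((\<lambda>R. L2_norm (\<lambda>\<xi>. f' \<xi> + g' \<xi> - fourier_L1 (truncate R (\<lambda>x. f x + g x)) \<xi>)) \<longlongrightarrow> 0) at_top"
  proof (rule Lim_null_comparison)
    show "((\<lambda>R. L2_norm (\<lambda>\<xi>. f' \<xi> - fourier_L1 (truncate R f) \<xi>)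
        + L2_norm (\<lambda>\<xi>. g' \<xi> - fourier_L1 (truncate R g) \<xi>)) \<longlongrightarrow> 0) at_top"
      using f g unfolding has_fourier_L2_def by (auto intro!: tendsto_add_zero)
    have "L2_norm (\<lambda>\<xi>. f' \<xi> + g' \<xi> - fourier_L1 (truncate R (\<lambda>x. f x + g x)) \<xi>)
        \<le> L2_norm (\<lambda>\<xi>. f' \<xi> - fourier_L1 (truncate R f) \<xi>)
        + L2_norm (\<lambda>\<xi>. g' \<xi> - fourier_L1 (truncate R g) \<xi>)" for R
      using L2_norm_triangle[OF L2_space_diff[OF L2(2) fourier_L1_truncate_L2[OF L2(1)]]
          L2_space_diff[OF L2(4) fourier_L1_truncate_L2[OF L2(3)]], of R R]
      unfolding eq by (simp add: algebra_simps)
    then show "\<forall>\<^sub>F R in at_top. norm (L2_norm (\<lambda>\<xi>. f' \<xi> + g' \<xi> - fourier_L1 (truncate R (\<lambda>x. f x + g x)) \<xi>))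
        \<le> L2_norm (\<lambda>\<xi>. f' \<xi> - fourier_L1 (truncate R f) \<xi>)
        + L2_norm (\<lambda>\<xi>. g' \<xi> - fourier_L1 (truncate R g) \<xi>)" by simp
  qed
  then show ?thesis
    using L2 by (simp add: has_fourier_L2_def L2_space_add)
qed

lemma has_fourier_L2_cmult:
  assumes f: "has_fourier_L2 f f'"
  shows "has_fourier_L2 (\<lambda>x. c * f x) (\<lambda>\<xi>. c * f' \<xi>)"
proof -
  have "fourier_L1 (truncate R (\<lambda>x. c * f x)) \<xi> = c * fourier_L1 (truncate R f) \<xi>" for R \<xi>
    using fourier_L1_cmult[of c "truncate R f" \<xi>] by (simp add: mult.left_commute)
  then have "L2_norm (\<lambda>\<xi>. c * f' \<xi> - fourier_L1 (truncate R (\<lambda>x. c * f x)) \<xi>)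
      = cmod c * L2_norm (\<lambda>\<xi>. f' \<xi> - fourier_L1 (truncate R f) \<xi>)" for R
    by (simp add: L2_norm_cmult flip: right_diff_distrib)
  then show ?thesis
    using f by (auto simp: has_fourier_L2_def L2_space_cmult intro: tendsto_mult_right_zero)
qed

lemma has_fourier_L2_diff:
  assumes "has_fourier_L2 f f'" and "has_fourier_L2 g g'"
  shows "has_fourier_L2 (\<lambda>x. f x - g x) (\<lambda>\<xi>. f' \<xi> - g' \<xi>)"
  using has_fourier_L2_add[OF assms(1) has_fourier_L2_cmult[OF assms(2), of "-1"]] by simp

lemma has_fourier_L2_sequentially:
  assumes "has_fourier_L2 f g"
  shows "(\<lambda>n. L2_norm (\<lambda>\<xi>. g \<xi> - fourier_L1 (truncate (real n) f) \<xi>)) \<longlonglongrightarrow> 0"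
  using assms filterlim_compose[OF _ filterlim_real_sequentially]
  by (auto simp: has_fourier_L2_def)

text \<open>A truncation of \<open>f\<close> lies in both L^1 and L^2, where the norm identity is
  known; both sides of it pass to the limit.\<close>

lemma Plancherel_L2:
  assumes g: "has_fourier_L2 f g"
  shows "L2_norm g = sqrt (2 * pi) * L2_norm f"
proof -
  have f: "f \<in> L2_space" and gL2: "g \<in> L2_space"
    using g by (auto simp: has_fourier_L2_def)
  have "(\<lambda>n. L2_norm g - L2_norm (fourier_L1 (truncate (real n) f))) \<longlonglongrightarrow> 0"
    by (rule Lim_null_comparison[OF _ has_fourier_L2_sequentially[OF g]])
      (use L2_norm_reverse_triangle[OF gL2 fourier_L1_truncate_L2[OF f]] in simp)
  moreover have "(\<lambda>n. L2_norm g - L2_norm (fourier_L1 (truncate (real n) f)))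
      \<longlonglongrightarrow> L2_norm g - sqrt (2 * pi) * L2_norm f"
    unfolding Plancherel_L1_L2(2)[OF integrable_truncate[OF f] L2_space_truncate[OF f]]
    by (intro tendsto_intros L2_norm_truncate_tendsto f)
  ultimately show ?thesis
    using LIMSEQ_unique by fastforce
qed

text \<open>By linearity the difference of two transforms is a transform of 0, and Plancherel gives
  it norm 0.\<close>

lemma has_fourier_L2_unique_AE:
  assumes "has_fourier_L2 f g" and "has_fourier_L2 f h"
  shows "AE \<xi> in lborel. g \<xi> = h \<xi>"
proof -
  have zero: "has_fourier_L2 (\<lambda>x. 0) (\<lambda>\<xi>. g \<xi> - h \<xi>)"
    using has_fourier_L2_diff[OF assms] by simp
  then have "L2_norm (\<lambda>\<xi>. g \<xi> - h \<xi>) = 0"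
    using Plancherel_L2[OF zero] by (simp add: L2_norm_def)
  then have "AE \<xi> in lborel. g \<xi> - h \<xi> = 0"
    using zero by (intro L2_norm_zero_AE) (auto simp: has_fourier_L2_def)
  then show ?thesis by simp
qed

text \<open>The transforms of the truncations converge to \<open>g\<close> in L^2 and, by dominated
  convergence, to \<open>fourier_L1 f\<close> pointwise. Fatou identifies the limits: the norm of
  their difference is at most a limit equal to 0.\<close>

lemma has_fourier_L2_eq_fourier_L1:
  assumes g: "has_fourier_L2 f g" and f1: "integrable lborel f"
  shows "AE \<xi> in lborel. g \<xi> = fourier_L1 f \<xi>"
proof -
  have f: "f \<in> L2_space" and gL2: "g \<in> L2_space"
    using g by (auto simp: has_fourier_L2_def)
  note [measurable] = f[THEN L2_space_measurable] gL2[THEN L2_space_measurable]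
  have lim: "(\<lambda>n. fourier_L1 (truncate (real n) f) \<xi>) \<longlonglongrightarrow> fourier_L1 f \<xi>" for \<xi>
    unfolding fourier_L1_def
  proof (rule integral_dominated_convergence[OF _ _ integrable_norm[OF f1]])
    show "AE x in lborel. (\<lambda>n. exp (- (\<i> * complex_of_real (x * \<xi>))) * truncate (real n) f x)
        \<longlonglongrightarrow> exp (- (\<i> * complex_of_real (x * \<xi>))) * f x"
      by (intro always_eventually allI tendsto_mult_left truncate_tendsto)
    show "AE x in lborel. norm (exp (- (\<i> * complex_of_real (x * \<xi>))) * truncate (real n) f x)
        \<le> norm (f x)" for n
      by (auto simp: norm_mult norm_exp_eq_Re indicator_def)
  qed measurable
  have mem: "(\<lambda>\<xi>. g \<xi> - fourier_L1 (truncate (real n) f) \<xi>) \<in> L2_space" for n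
    by (intro L2_space_diff gL2 fourier_L1_truncate_L2 f)
  have AE: "AE \<xi> in lborel. (\<lambda>n. g \<xi> - fourier_L1 (truncate (real n) f) \<xi>) \<longlonglongrightarrow> g \<xi> - fourier_L1 f \<xi>"
    by (intro always_eventually allI tendsto_intros lim)
  have meas: "(\<lambda>\<xi>. g \<xi> - fourier_L1 f \<xi>) \<in> borel_measurable borel"
    by measurable
  note F = L2_norm_Fatou[OF meas mem AE order_refl has_fourier_L2_sequentially[OF g]]
  have "AE \<xi> in lborel. g \<xi> - fourier_L1 f \<xi> = 0"
    using F(2) L2_norm_nonneg by (intro L2_norm_zero_AE F(1)) (rule antisym)
  then show ?thesis by simp
qed

text \<open>The \<open>SOME\<close> in \<open>fourier_L2\<close> denotes a transform only if there
  is one. The definition of \<open>sobolev\<close> supplies the witness for the functions at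
  hand.\<close>

lemma has_fourier_L2_fourier_L2: "has_fourier_L2 f g \<Longrightarrow> has_fourier_L2 f (fourier_L2 f)"
  unfolding fourier_L2_def by (rule someI[of "has_fourier_L2 f"])

lemma fourier_L2_AE_eq: "has_fourier_L2 f g \<Longrightarrow> AE \<xi> in lborel. fourier_L2 f \<xi> = g \<xi>"
  by (rule has_fourier_L2_unique_AE[OF has_fourier_L2_fourier_L2])

lemma fourier_L2_AE_zero:
  assumes "has_fourier_L2 f g" "AE x in lborel. f x = 0"
  shows "AE \<xi> in lborel. fourier_L2 f \<xi> = 0"
proof -
  have f: "f \<in> L2_space" using assms(1) by (simp add: has_fourier_L2_def)
  note F = has_fourier_L2_fourier_L2[OF assms(1)]
  have "L2_norm f = L2_norm (\<lambda>_. 0)"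
    using f assms(2) by (intro L2_norm_cong_AE) auto
  then have "L2_norm (fourier_L2 f) = 0"
    using Plancherel_L2[OF F] by (simp add: L2_norm_def)
  then show ?thesis
    using F by (intro L2_norm_zero_AE) (auto simp: has_fourier_L2_def)
qed

section \<open>Sobolev spaces on the Fourier side\<close>

lemma sobolev_has_fourier: "f \<in> sobolev s \<Longrightarrow> has_fourier_L2 f (fourier_L2 f)"
  by (auto simp: sobolev_def intro: has_fourier_L2_fourier_L2)

lemma fourier_L2_in_L2: "f \<in> sobolev s \<Longrightarrow> fourier_L2 f \<in> L2_space"
  using sobolev_has_fourier[of f s] by (simp add: has_fourier_L2_def)

lemma sobolev_integrable:
  assumes "f \<in> sobolev s"
  shows "integrable lborel (\<lambda>\<xi>. (1 + \<xi>\<^sup>2) powr s * (cmod (fourier_L2 f \<xi>))\<^sup>2)"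
proof -
  obtain g where g: "has_fourier_L2 f g"
    and int: "integrable lborel (\<lambda>\<xi>. (1 + \<xi>\<^sup>2) powr s * (cmod (g \<xi>))\<^sup>2)"
    using assms by (auto simp: sobolev_def)
  have [measurable]: "g \<in> borel_measurable borel" "fourier_L2 f \<in> borel_measurable borel"
    using g fourier_L2_in_L2[OF assms] by (auto simp: has_fourier_L2_def)
  have "AE \<xi> in lborel. (1 + \<xi>\<^sup>2) powr s * (cmod (g \<xi>))\<^sup>2 = (1 + \<xi>\<^sup>2) powr s * (cmod (fourier_L2 f \<xi>))\<^sup>2"
    using fourier_L2_AE_eq[OF g] by eventually_elim simp
  with int show ?thesis
    by (subst (asm) integrable_cong_AE) auto
qed

lemma sobolevI:
  assumes f: "has_fourier_L2 f g" and [measurable]: "w \<in> borel_measurable borel"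
    and int: "integrable lborel w" and bound: "\<And>\<xi>. (1 + \<xi>\<^sup>2) powr s * (cmod (g \<xi>))\<^sup>2 \<le> w \<xi>"
  shows "f \<in> sobolev s"
proof -
  have [measurable]: "g \<in> borel_measurable borel"
    using f by (auto simp: has_fourier_L2_def)
  have "integrable lborel (\<lambda>\<xi>. (1 + \<xi>\<^sup>2) powr s * (cmod (g \<xi>))\<^sup>2)"
    by (rule Bochner_Integration.integrable_bound[OF int])
      (use bound order_trans[OF bound abs_ge_self] in auto)
  then show ?thesis
    using f by (auto simp: sobolev_def has_fourier_L2_def)
qed

lemma sobolev_cmult:
  assumes "f \<in> sobolev s" shows "(\<lambda>x. c * f x) \<in> sobolev s"
  by (rule sobolevI[OF has_fourier_L2_cmult[OF sobolev_has_fourier[OF assms]] _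
        integrable_mult_right[OF sobolev_integrable[OF assms], of "(cmod c)\<^sup>2"]])
    (use fourier_L2_in_L2[OF assms] in \<open>auto simp: norm_mult power_mult_distrib\<close>)

lemma sobolev_diff:
  assumes f: "f \<in> sobolev s" and g: "g \<in> sobolev s"
  shows "(\<lambda>x. f x - g x) \<in> sobolev s"
proof (rule sobolevI[OF has_fourier_L2_diff[OF sobolev_has_fourier[OF f] sobolev_has_fourier[OF g]]])
  let ?w = "\<lambda>\<xi>. 2 * ((1 + \<xi>\<^sup>2) powr s * (cmod (fourier_L2 f \<xi>))\<^sup>2)
    + 2 * ((1 + \<xi>\<^sup>2) powr s * (cmod (fourier_L2 g \<xi>))\<^sup>2)"
  show int: "integrable lborel ?w"
    using sobolev_integrable[OF f] sobolev_integrable[OF g] by simp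
  then show "?w \<in> borel_measurable borel" by simp
  fix \<xi>
  let ?a = "fourier_L2 f \<xi>" and ?b = "fourier_L2 g \<xi>"
  have "(cmod (?a - ?b))\<^sup>2 \<le> (cmod ?a + cmod ?b)\<^sup>2"
    by (intro power_mono norm_triangle_ineq4) simp
  also have "\<dots> \<le> 2 * (cmod ?a)\<^sup>2 + 2 * (cmod ?b)\<^sup>2"
    using sum_squares_bound[of "cmod ?a" "cmod ?b"] by (simp add: power2_sum)
  finally have "(1 + \<xi>\<^sup>2) powr s * (cmod (?a - ?b))\<^sup>2
      \<le> (1 + \<xi>\<^sup>2) powr s * (2 * (cmod ?a)\<^sup>2 + 2 * (cmod ?b)\<^sup>2)"
    by (intro mult_left_mono) simp_all
  then show "(1 + \<xi>\<^sup>2) powr s * (cmod (?a - ?b))\<^sup>2 \<le> ?w \<xi>"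
    by (simp add: distrib_left mult.left_commute)
qed

lemma L2_norm_fourier_le_sobolev_norm:
  assumes f: "f \<in> sobolev s" and s: "0 \<le> s"
  shows "L2_norm (fourier_L2 f) \<le> sobolev_norm s f"
proof -
  have "(LINT \<xi>|lborel. (cmod (fourier_L2 f \<xi>))\<^sup>2)
      \<le> (LINT \<xi>|lborel. (1 + \<xi>\<^sup>2) powr s * (cmod (fourier_L2 f \<xi>))\<^sup>2)"
  proof (rule integral_mono[OF L2_space_integrable[OF fourier_L2_in_L2[OF f]] sobolev_integrable[OF f]])
    fix \<xi> :: real
    have "1 \<le> (1 + \<xi>\<^sup>2) powr s"
      using s by (simp add: ge_one_powr_ge_zero)
    then show "(cmod (fourier_L2 f \<xi>))\<^sup>2 \<le> (1 + \<xi>\<^sup>2) powr s * (cmod (fourier_L2 f \<xi>))\<^sup>2"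
      by (simp add: mult_le_cancel_right1)
  qed
  then show ?thesis
    by (simp add: L2_norm_def sobolev_norm_def)
qed

lemma C1_sobolev_mem:
  assumes "C1_sobolev s u v" "0 \<le> t"
  shows "u t \<in> sobolev s" and "v t \<in> sobolev s"
  using assms by (auto simp: C1_sobolev_def continuous_sobolev_def)

text \<open>For \<open>s \<ge> 0\<close> the Sobolev norm dominates the L^2 norm of the transform.
  Differentiability in the Sobolev space thus becomes L^2 differentiability of the transforms, the
  form in which the oscillator argument uses it.\<close>

lemma C1_sobolev_fourier_tendsto:
  assumes C1: "C1_sobolev s u v" and s: "0 \<le> s" and t: "0 \<le> t"
  shows "((\<lambda>\<tau>. L2_norm (\<lambda>\<xi>. (fourier_L2 (u \<tau>) \<xi> - fourier_L2 (u t) \<xi>) /\<^sub>R (\<tau> - t) - fourier_L2 (v t) \<xi>))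
    \<longlongrightarrow> 0) (at t within {0..})"
proof (rule Lim_null_comparison)
  let ?q = "\<lambda>\<tau> x. (u \<tau> x - u t x) /\<^sub>R (\<tau> - t) - v t x"
  show "((\<lambda>\<tau>. sobolev_norm s (?q \<tau>)) \<longlongrightarrow> 0) (at t within {0..})"
    using C1 t by (simp add: C1_sobolev_def)
  have "L2_norm (\<lambda>\<xi>. (fourier_L2 (u \<tau>) \<xi> - fourier_L2 (u t) \<xi>) /\<^sub>R (\<tau> - t) - fourier_L2 (v t) \<xi>)
      \<le> sobolev_norm s (?q \<tau>)" if \<tau>: "0 \<le> \<tau>" for \<tau>
  proof -
    note mem = C1_sobolev_mem[OF C1]
    let ?c = "complex_of_real (inverse (\<tau> - t))"
    have q: "(\<lambda>x. ?c * (u \<tau> x - u t x) - v t x) \<in> sobolev s"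
      by (intro sobolev_diff sobolev_cmult mem \<tau> t)
    have "has_fourier_L2 (\<lambda>x. ?c * (u \<tau> x - u t x) - v t x)
        (\<lambda>\<xi>. ?c * (fourier_L2 (u \<tau>) \<xi> - fourier_L2 (u t) \<xi>) - fourier_L2 (v t) \<xi>)" (is "has_fourier_L2 ?f ?g")
      by (intro has_fourier_L2_diff has_fourier_L2_cmult sobolev_has_fourier[where s = s] mem \<tau> t)
    \<comment> \<open>Since \<open>fourier_L2\<close> chooses representatives, it is linear only up
      to null sets; the norms nevertheless agree.\<close>
    then have "L2_norm ?g = L2_norm (fourier_L2 ?f)"
      using fourier_L2_in_L2[OF q] fourier_L2_AE_eq[of ?f ?g]
      by (intro L2_norm_cong_AE) (auto simp: has_fourier_L2_def elim: eventually_mono)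
    also have "\<dots> \<le> sobolev_norm s ?f"
      by (rule L2_norm_fourier_le_sobolev_norm[OF q s])
    finally show ?thesis
      by (simp add: scaleR_conv_of_real)
  qed
  then show "\<forall>\<^sub>F \<tau> in at t within {0..}.
      norm (L2_norm (\<lambda>\<xi>. (fourier_L2 (u \<tau>) \<xi> - fourier_L2 (u t) \<xi>) /\<^sub>R (\<tau> - t) - fourier_L2 (v t) \<xi>))
      \<le> sobolev_norm s (?q \<tau>)"
    by (auto simp: eventually_at_filter)
qed

subsection \<open>The oscillator equation in \<open>L\<^sup>2\<close>\<close>

text \<open>Both are components of one complex estimate: the remainder of
  \<open>exp (\<i> k)\<close> after its linear term, rotated by \<open>exp (\<i> y)\<close>.\<close>

lemma
  fixes y k :: real
  shows cos_Taylor_remainder: "\<bar>cos y - cos (y + k) - k * sin y\<bar> \<le> k\<^sup>2"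
    and sin_Taylor_remainder: "\<bar>sin y - sin (y + k) + k * cos y\<bar> \<le> k\<^sup>2"
proof -
  let ?r = "iexp y * (iexp k - (1 + \<i> * k))"
  have "cmod ?r = cmod (iexp k - (\<Sum>j\<le>1. (\<i> * k) ^ j / fact j))"
    by (simp add: norm_mult)
  also have "\<dots> \<le> k\<^sup>2 / 2"
    using iexp_approx1[of k 1] by (simp add: numeral_2_eq_2)
  also have "\<dots> \<le> k\<^sup>2" by simp
  finally have r: "cmod ?r \<le> k\<^sup>2" .
  have "Re ?r = cos (y + k) - cos y + k * sin y" "Im ?r = sin (y + k) - sin y - k * cos y"
    by (simp_all add: cis_conv_exp[symmetric] cos_add sin_add algebra_simps)
  with abs_Re_le_cmod[of ?r] abs_Im_le_cmod[of ?r] r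
  show "\<bar>cos y - cos (y + k) - k * sin y\<bar> \<le> k\<^sup>2" "\<bar>sin y - sin (y + k) + k * cos y\<bar> \<le> k\<^sup>2"
    by linarith+
qed

lemma abs_sin_diff_le:
  fixes a b :: real shows "\<bar>sin a - sin b\<bar> \<le> \<bar>a - b\<bar>"
proof -
  have "\<bar>sin a - sin b\<bar> = 2 * (\<bar>sin ((a - b) / 2)\<bar> * \<bar>cos ((a + b) / 2)\<bar>)"
    by (simp add: sin_diff_sin abs_mult)
  also have "\<dots> \<le> 2 * (\<bar>(a - b) / 2\<bar> * 1)"
    by (intro mult_left_mono mult_mono abs_sin_x_le_abs_x abs_cos_le_one) simp_all
  finally show ?thesis by simp
qed

lemma L2_norm_bound_mem:
  assumes "g \<in> L2_space" and "f \<in> borel_measurable borel"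
    and "\<And>x. cmod (f x) \<le> C * cmod (g x)" and "0 \<le> C"
  shows "f \<in> L2_space \<and> L2_norm f \<le> C * L2_norm g"
  using assms by (auto intro: L2_space_bound L2_norm_bound)

text \<open>Variation of constants: for \<open>W' = U\<close>, \<open>U' = q - \<phi>\<^sup>2 W\<close> the combination
  \<open>cos ((T - t) \<phi>) U - \<phi> sin ((T - t) \<phi>) W - (sin (T \<phi>) - sin ((T - t) \<phi>)) / \<phi> q\<close>
  does not depend on \<open>t\<close>; compare \<open>t = 0\<close> with \<open>t = T\<close>.\<close>

lemma L2_oscillator_solution:
  fixes W U V :: "real \<Rightarrow> real \<Rightarrow> complex" and \<phi> :: "real \<Rightarrow> real"
  assumes \<phi> [measurable]: "\<phi> \<in> borel_measurable borel" and \<phi>_pos: "\<And>\<xi>. 0 < \<phi> \<xi>" and \<phi>_le: "\<And>\<xi>. \<phi> \<xi> \<le> M"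
    and L2: "\<And>t. 0 \<le> t \<Longrightarrow> W t \<in> L2_space" "\<And>t. 0 \<le> t \<Longrightarrow> U t \<in> L2_space" "q \<in> L2_space"
    and DW: "\<And>t. 0 \<le> t \<Longrightarrow> ((\<lambda>\<tau>. L2_norm (\<lambda>\<xi>. (W \<tau> \<xi> - W t \<xi>) /\<^sub>R (\<tau> - t) - U t \<xi>)) \<longlongrightarrow> 0) (at t within {0..})"
    and DU: "\<And>t. 0 \<le> t \<Longrightarrow> ((\<lambda>\<tau>. L2_norm (\<lambda>\<xi>. (U \<tau> \<xi> - U t \<xi>) /\<^sub>R (\<tau> - t) - V t \<xi>)) \<longlongrightarrow> 0) (at t within {0..})"
    and V: "\<And>t. 0 \<le> t \<Longrightarrow> V t \<in> L2_space"
      "\<And>t. 0 \<le> t \<Longrightarrow> AE \<xi> in lborel. V t \<xi> = q \<xi> - complex_of_real ((\<phi> \<xi>)\<^sup>2) * W t \<xi>"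
    and W0: "AE \<xi> in lborel. W 0 \<xi> = 0" and T: "0 \<le> T"
  shows "AE \<xi> in lborel. U T \<xi> = complex_of_real (cos (T * \<phi> \<xi>)) * U 0 \<xi>
    + complex_of_real (sin (T * \<phi> \<xi>) / \<phi> \<xi>) * q \<xi>"
proof -
  have M: "0 < M" using \<phi>_pos[of 0] \<phi>_le[of 0] by linarith
  \<comment> \<open>This is the integral of \<open>cos ((T - s) \<phi>)\<close> over
    \<open>s\<close> from 0 to \<open>t\<close>, the response to the constant force
    \<open>q\<close>. Hence it is at most \<open>\<bar>t\<bar>\<close>, however small
    \<open>\<phi>\<close> is.\<close>
  define \<sigma> where "\<sigma> = (\<lambda>t \<xi>. (sin (T * \<phi> \<xi>) - sin ((T - t) * \<phi> \<xi>)) / \<phi> \<xi>)"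
  define F where "F = (\<lambda>t \<xi>. complex_of_real (cos ((T - t) * \<phi> \<xi>)) * U t \<xi>
    - complex_of_real (\<phi> \<xi> * sin ((T - t) * \<phi> \<xi>)) * W t \<xi> - complex_of_real (\<sigma> t \<xi>) * q \<xi>)"
  have \<sigma>_meas [measurable]: "\<sigma> t \<in> borel_measurable borel" for t
    unfolding \<sigma>_def by measurable
  have \<sigma>_le: "\<bar>\<sigma> t \<xi>\<bar> \<le> \<bar>t\<bar>" for t \<xi>
  proof -
    have "\<bar>sin (T * \<phi> \<xi>) - sin ((T - t) * \<phi> \<xi>)\<bar> \<le> \<bar>T * \<phi> \<xi> - (T - t) * \<phi> \<xi>\<bar>"
      by (rule abs_sin_diff_le)
    also have "\<dots> = \<bar>t\<bar> * \<phi> \<xi>"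
      using \<phi>_pos[of \<xi>] by (simp add: left_diff_distrib abs_mult)
    finally show ?thesis
      using \<phi>_pos[of \<xi>] by (simp add: \<sigma>_def pos_divide_le_eq)
  qed
  have \<phi>sin: "\<bar>\<phi> \<xi> * sin s\<bar> \<le> M" for \<xi> s
  proof -
    have "\<bar>\<phi> \<xi>\<bar> * \<bar>sin s\<bar> \<le> M * 1"
      using \<phi>_pos[of \<xi>] \<phi>_le[of \<xi>] M by (intro mult_mono) auto
    then show ?thesis by (simp add: abs_mult)
  qed
  have F_L2: "F t \<in> L2_space" if "0 \<le> t" for t
  proof -
    have "(\<lambda>\<xi>. complex_of_real (cos ((T - t) * \<phi> \<xi>)) * U t \<xi>) \<in> L2_space"
      by (rule L2_space_mult_bounded[OF L2(2)[OF that], where C = 1]) (simp_all only: norm_of_real abs_cos_le_one, measurable)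
    moreover have "(\<lambda>\<xi>. complex_of_real (\<phi> \<xi> * sin ((T - t) * \<phi> \<xi>)) * W t \<xi>) \<in> L2_space"
      by (rule L2_space_mult_bounded[OF L2(1)[OF that], where C = M]) (simp_all only: norm_of_real \<phi>sin, measurable)
    moreover have "(\<lambda>\<xi>. complex_of_real (\<sigma> t \<xi>) * q \<xi>) \<in> L2_space"
      by (rule L2_space_mult_bounded[OF L2(3), where C = "\<bar>t\<bar>"]) (simp_all only: norm_of_real \<sigma>_le, measurable)
    ultimately show ?thesis
      unfolding F_def by (intro L2_space_diff)
  qed
  \<comment> \<open>Constancy of the map \<open>F\<close> into L^2 is reduced to that of the scalar
    \<open>p\<close>: by the reverse triangle inequality the difference quotients of
    \<open>p\<close> are controlled by the norms of the increments of \<open>F\<close>.\<close>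
  define p where "p = (\<lambda>t. L2_norm (\<lambda>\<xi>. F t \<xi> - F 0 \<xi>))"
  have F_diff: "L2_norm (\<lambda>\<xi>. F \<tau> \<xi> - F t \<xi>) \<le> \<bar>\<tau> - t\<bar> * (
      L2_norm (\<lambda>\<xi>. (U \<tau> \<xi> - U t \<xi>) /\<^sub>R (\<tau> - t) - V t \<xi>)
      + M * L2_norm (\<lambda>\<xi>. (W \<tau> \<xi> - W t \<xi>) /\<^sub>R (\<tau> - t) - U t \<xi>)
      + \<bar>\<tau> - t\<bar> * (M\<^sup>2 * L2_norm (U t) + M ^ 3 * L2_norm (W t) + M * L2_norm q))"
    if t: "0 \<le> t" and \<tau>: "0 \<le> \<tau>" and neq: "\<tau> \<noteq> t" for \<tau> t
  proof -
    define h where "h = \<tau> - t"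
    have h: "h \<noteq> 0" using neq by (simp add: h_def)
    define RU where "RU = (\<lambda>\<xi>. (U \<tau> \<xi> - U t \<xi>) /\<^sub>R h - V t \<xi>)"
    define RW where "RW = (\<lambda>\<xi>. (W \<tau> \<xi> - W t \<xi>) /\<^sub>R h - U t \<xi>)"
    have R_L2: "RU \<in> L2_space" "RW \<in> L2_space"
      unfolding RU_def RW_def scaleR_conv_of_real
      by (intro L2_space_diff L2_space_cmult L2 V t \<tau>)+
    note [measurable] = R_L2[THEN L2_space_measurable] L2(1,2)[OF t, THEN L2_space_measurable]
      L2(3)[THEN L2_space_measurable]
    define c where "c = (\<lambda>t \<xi>. cos ((T - t) * \<phi> \<xi>))"
    define s where "s = (\<lambda>t \<xi>. sin ((T - t) * \<phi> \<xi>))"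
    have [measurable]: "c t \<in> borel_measurable borel" "s t \<in> borel_measurable borel" for t
      unfolding c_def s_def by measurable
    \<comment> \<open>\<open>A1\<close> and \<open>A2\<close> carry the errors of the difference
      quotients of \<open>U\<close> and \<open>W\<close>, which are o(h). \<open>A3\<close>,
      \<open>A4\<close> and \<open>A5\<close> carry the second-order errors of the coefficients of
      \<open>U t\<close>, \<open>W t\<close> and \<open>q\<close>. The first-order terms cancel by
      the equation for \<open>V t\<close>.\<close>
    define A1 where "A1 = (\<lambda>\<xi>. complex_of_real (h * c \<tau> \<xi>) * RU \<xi>)"
    define A2 where "A2 = (\<lambda>\<xi>. complex_of_real (- h * (\<phi> \<xi> * s \<tau> \<xi>)) * RW \<xi>)"
    define A3 where "A3 = (\<lambda>\<xi>. complex_of_real (c \<tau> \<xi> - c t \<xi> - h * \<phi> \<xi> * s \<tau> \<xi>) * U t \<xi>)"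
    define A4 where "A4 = (\<lambda>\<xi>. complex_of_real (- \<phi> \<xi> * (s \<tau> \<xi> - s t \<xi> + h * \<phi> \<xi> * c \<tau> \<xi>)) * W t \<xi>)"
    define A5 where "A5 = (\<lambda>\<xi>. complex_of_real (h * c \<tau> \<xi> - (\<sigma> \<tau> \<xi> - \<sigma> t \<xi>)) * q \<xi>)"
    have cs: "cos ((T - t) * \<phi> \<xi>) = c t \<xi>" "sin ((T - t) * \<phi> \<xi>) = s t \<xi>" for t \<xi>
      by (simp_all add: c_def s_def)
    have shift: "(T - t) * \<phi> \<xi> = (T - \<tau>) * \<phi> \<xi> + h * \<phi> \<xi>" for \<xi>
      by (simp add: h_def algebra_simps)
    have c_rem: "\<bar>c \<tau> \<xi> - c t \<xi> - h * \<phi> \<xi> * s \<tau> \<xi>\<bar> \<le> (h * \<phi> \<xi>)\<^sup>2" for \<xi>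
      unfolding c_def s_def shift by (rule cos_Taylor_remainder)
    have s_rem: "\<bar>s \<tau> \<xi> - s t \<xi> + h * \<phi> \<xi> * c \<tau> \<xi>\<bar> \<le> (h * \<phi> \<xi>)\<^sup>2" for \<xi>
      unfolding c_def s_def shift by (rule sin_Taylor_remainder)
    have \<phi>_pow: "\<phi> \<xi> ^ n \<le> M ^ n" for \<xi> n
      using \<phi>_pos[of \<xi>] by (intro power_mono \<phi>_le) simp
    have B1: "A1 \<in> L2_space \<and> L2_norm A1 \<le> \<bar>h\<bar> * L2_norm RU"
    proof (rule L2_norm_bound_mem[OF R_L2(1)])
      show "cmod (A1 \<xi>) \<le> \<bar>h\<bar> * cmod (RU \<xi>)" for \<xi>
        by (auto simp: A1_def norm_mult c_def abs_mult intro!: mult_right_mono mult_left_le)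
    qed (auto simp: A1_def)
    have B2: "A2 \<in> L2_space \<and> L2_norm A2 \<le> (\<bar>h\<bar> * M) * L2_norm RW"
    proof (rule L2_norm_bound_mem[OF R_L2(2)])
      have "\<bar>- h * (\<phi> \<xi> * s \<tau> \<xi>)\<bar> \<le> \<bar>h\<bar> * M" for \<xi>
        unfolding abs_mult[of "- h"] s_def using \<phi>sin by (simp add: mult_left_mono)
      then show "cmod (A2 \<xi>) \<le> (\<bar>h\<bar> * M) * cmod (RW \<xi>)" for \<xi>
        unfolding A2_def norm_mult norm_of_real by (intro mult_right_mono) simp_all
    qed (use M in \<open>auto simp: A2_def\<close>)
    have B3: "A3 \<in> L2_space \<and> L2_norm A3 \<le> (h\<^sup>2 * M\<^sup>2) * L2_norm (U t)"
    proof (rule L2_norm_bound_mem[OF L2(2)[OF t]])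
      have "\<bar>c \<tau> \<xi> - c t \<xi> - h * \<phi> \<xi> * s \<tau> \<xi>\<bar> \<le> h\<^sup>2 * M\<^sup>2" for \<xi>
        using c_rem[of \<xi>] mult_left_mono[OF \<phi>_pow[of \<xi> 2], of "h\<^sup>2"] by (simp add: power_mult_distrib)
      then show "cmod (A3 \<xi>) \<le> (h\<^sup>2 * M\<^sup>2) * cmod (U t \<xi>)" for \<xi>
        unfolding A3_def norm_mult norm_of_real by (intro mult_right_mono) simp_all
    qed (auto simp: A3_def)
    have B4: "A4 \<in> L2_space \<and> L2_norm A4 \<le> (h\<^sup>2 * M ^ 3) * L2_norm (W t)"
    proof (rule L2_norm_bound_mem[OF L2(1)[OF t]])
      have "\<bar>- \<phi> \<xi> * (s \<tau> \<xi> - s t \<xi> + h * \<phi> \<xi> * c \<tau> \<xi>)\<bar> \<le> h\<^sup>2 * M ^ 3" for \<xi>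
      proof -
        have "\<bar>- \<phi> \<xi> * (s \<tau> \<xi> - s t \<xi> + h * \<phi> \<xi> * c \<tau> \<xi>)\<bar> \<le> \<phi> \<xi> * (h * \<phi> \<xi>)\<^sup>2"
          unfolding abs_mult[of "- \<phi> \<xi>"] using s_rem[of \<xi>] \<phi>_pos[of \<xi>]
          by (simp add: mult_left_mono)
        also have "\<dots> = h\<^sup>2 * \<phi> \<xi> ^ 3"
          by (simp add: power2_eq_square power3_eq_cube)
        also have "\<dots> \<le> h\<^sup>2 * M ^ 3"
          using \<phi>_pow by (intro mult_left_mono) simp_all
        finally show ?thesis .
      qed
      then show "cmod (A4 \<xi>) \<le> (h\<^sup>2 * M ^ 3) * cmod (W t \<xi>)" for \<xi>
        unfolding A4_def norm_mult norm_of_real by (intro mult_right_mono) simp_all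
    qed (use M in \<open>auto simp: A4_def\<close>)
    \<comment> \<open>The remainder is quadratic in \<open>\<phi>\<close> and so absorbs the
      division by \<open>\<phi>\<close>.\<close>
    have B5: "A5 \<in> L2_space \<and> L2_norm A5 \<le> (h\<^sup>2 * M) * L2_norm q"
    proof (rule L2_norm_bound_mem[OF L2(3)])
      have "\<bar>h * c \<tau> \<xi> - (\<sigma> \<tau> \<xi> - \<sigma> t \<xi>)\<bar> \<le> h\<^sup>2 * M" for \<xi>
      proof -
        have "h * c \<tau> \<xi> - (\<sigma> \<tau> \<xi> - \<sigma> t \<xi>) = (s \<tau> \<xi> - s t \<xi> + h * \<phi> \<xi> * c \<tau> \<xi>) / \<phi> \<xi>"
          using \<phi>_pos[of \<xi>] by (simp add: \<sigma>_def s_def field_simps)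
        then have "\<bar>h * c \<tau> \<xi> - (\<sigma> \<tau> \<xi> - \<sigma> t \<xi>)\<bar> \<le> (h * \<phi> \<xi>)\<^sup>2 / \<phi> \<xi>"
          using s_rem[of \<xi>] \<phi>_pos[of \<xi>] by (simp add: divide_right_mono)
        also have "\<dots> = h\<^sup>2 * \<phi> \<xi>"
          using \<phi>_pos[of \<xi>] by (simp add: power2_eq_square)
        also have "\<dots> \<le> h\<^sup>2 * M"
          using \<phi>_le by (intro mult_left_mono) simp_all
        finally show ?thesis .
      qed
      then show "cmod (A5 \<xi>) \<le> (h\<^sup>2 * M) * cmod (q \<xi>)" for \<xi>
        unfolding A5_def norm_mult norm_of_real by (intro mult_right_mono) simp_all
    qed (use M in \<open>auto simp: A5_def\<close>)
    have "AE \<xi> in lborel. F \<tau> \<xi> - F t \<xi> = A1 \<xi> + A2 \<xi> + A3 \<xi> + A4 \<xi> + A5 \<xi>"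
      using V(2)[OF t]
    proof eventually_elim
      case (elim \<xi>)
      have U\<tau>: "U \<tau> \<xi> = U t \<xi> + complex_of_real h * (RU \<xi> + V t \<xi>)"
        and W\<tau>: "W \<tau> \<xi> = W t \<xi> + complex_of_real h * (RW \<xi> + U t \<xi>)"
        using h by (simp_all add: RU_def RW_def scaleR_conv_of_real field_simps)
      show ?case
        unfolding F_def cs A1_def A2_def A3_def A4_def A5_def U\<tau> W\<tau> elim
        by (simp add: algebra_simps power2_eq_square)
    qed
    then have "L2_norm (\<lambda>\<xi>. F \<tau> \<xi> - F t \<xi>) = L2_norm (\<lambda>\<xi>. A1 \<xi> + A2 \<xi> + A3 \<xi> + A4 \<xi> + A5 \<xi>)"
      using F_L2[OF t] F_L2[OF \<tau>] B1 B2 B3 B4 B5 by (intro L2_norm_cong_AE) auto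
    also have "\<dots> \<le> L2_norm A1 + L2_norm A2 + L2_norm A3 + L2_norm A4 + L2_norm A5"
      using B1 B2 B3 B4 B5
      by (intro order_trans[OF L2_norm_triangle] add_right_mono L2_space_add order_refl) auto
    also have "\<dots> \<le> \<bar>h\<bar> * L2_norm RU + (\<bar>h\<bar> * M) * L2_norm RW + (h\<^sup>2 * M\<^sup>2) * L2_norm (U t)
        + (h\<^sup>2 * M ^ 3) * L2_norm (W t) + (h\<^sup>2 * M) * L2_norm q"
      using B1 B2 B3 B4 B5 by (intro add_mono) auto
    also have "\<dots> = \<bar>h\<bar> * (L2_norm RU + M * L2_norm RW
        + \<bar>h\<bar> * (M\<^sup>2 * L2_norm (U t) + M ^ 3 * L2_norm (W t) + M * L2_norm q))"
      unfolding power2_abs[of h, symmetric] power2_eq_square[of "\<bar>h\<bar>"] by (simp add: algebra_simps)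
    finally show ?thesis
      unfolding RU_def RW_def h_def .
  qed
  have "(p has_field_derivative 0) (at t within {0..})" if t: "t \<in> {0..}" for t
    unfolding has_field_derivative_iff
  proof (rule Lim_null_comparison)
    let ?g = "\<lambda>\<tau>. L2_norm (\<lambda>\<xi>. (U \<tau> \<xi> - U t \<xi>) /\<^sub>R (\<tau> - t) - V t \<xi>)
      + M * L2_norm (\<lambda>\<xi>. (W \<tau> \<xi> - W t \<xi>) /\<^sub>R (\<tau> - t) - U t \<xi>)
      + \<bar>\<tau> - t\<bar> * (M\<^sup>2 * L2_norm (U t) + M ^ 3 * L2_norm (W t) + M * L2_norm q)"
    have t0: "0 \<le> t" using t by simp
    have "(?g \<longlongrightarrow> 0 + M * 0 + \<bar>t - t\<bar> * (M\<^sup>2 * L2_norm (U t) + M ^ 3 * L2_norm (W t) + M * L2_norm q))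
        (at t within {0..})"
      by (intro tendsto_intros DU DW t0)
    then show "(?g \<longlongrightarrow> 0) (at t within {0..})" by simp
    have "norm ((p \<tau> - p t) / (\<tau> - t)) \<le> ?g \<tau>" if \<tau>: "0 \<le> \<tau>" "\<tau> \<noteq> t" for \<tau>
    proof -
      have "\<bar>p \<tau> - p t\<bar> \<le> L2_norm (\<lambda>\<xi>. (F \<tau> \<xi> - F 0 \<xi>) - (F t \<xi> - F 0 \<xi>))"
        unfolding p_def using \<tau> t by (intro L2_norm_reverse_triangle L2_space_diff F_L2) auto
      also have "\<dots> \<le> \<bar>\<tau> - t\<bar> * ?g \<tau>"
        using F_diff[OF t0 \<tau>] by simp
      finally show ?thesis
        using \<tau>(2) by (simp add: abs_divide pos_divide_le_eq mult.commute)
    qed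
    then show "\<forall>\<^sub>F \<tau> in at t within {0..}. norm ((p \<tau> - p t) / (\<tau> - t)) \<le> ?g \<tau>"
      by (auto simp: eventually_at_filter)
  qed
  then obtain k where k: "\<And>t. t \<in> {0..} \<Longrightarrow> p t = k"
    using has_field_derivative_zero_constant[of "{0..}" p] by auto
  have "p T = p 0"
    using k[of T] k[of 0] T by simp
  then have "L2_norm (\<lambda>\<xi>. F T \<xi> - F 0 \<xi>) = 0"
    by (simp add: p_def L2_norm_def)
  then have "AE \<xi> in lborel. F T \<xi> - F 0 \<xi> = 0"
    using T by (intro L2_norm_zero_AE L2_space_diff F_L2) auto
  \<comment> \<open>At \<open>t = T\<close> the cosine is 1 and the sine 0, leaving
    \<open>U T - sin (T \<phi>) / \<phi> q\<close>. At \<open>t = 0\<close> both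
    \<open>\<sigma>\<close> and \<open>W\<close> vanish, leaving
    \<open>cos (T \<phi>) U 0\<close>.\<close>
  then show ?thesis
    using W0 by eventually_elim (simp add: F_def \<sigma>_def algebra_simps)
qed

subsection \<open>The solution on the Fourier side and its growth\<close>

lemma integrable_inverse_one_plus_square: "integrable lborel (\<lambda>x::real. 1 / (1 + x\<^sup>2))"
proof -
  have i: "integrable lborel (\<lambda>x::real. indicator {0<..} x *\<^sub>R (1 / (1 + x\<^sup>2)))"
    using integrable_I0i_1_div_plus_square
    by (simp add: interval_lebesgue_integrable_def set_integrable_def einterval_def zero_ereal_def greaterThan_def)
  have "integrable lborel (\<lambda>x::real. indicator {0<..} x *\<^sub>R (1 / (1 + x\<^sup>2)) + indicator {0<..} (- x) *\<^sub>R (1 / (1 + x\<^sup>2)))"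
    using lborel_integrable_real_affine[OF i, of "-1" 0] i by (intro Bochner_Integration.integrable_add) simp_all
  then show ?thesis
  proof (rule integrable_cong_AE_imp)
    show "AE x in lborel. indicator {0<..} x *\<^sub>R (1 / (1 + x\<^sup>2)) + indicator {0<..} (- x) *\<^sub>R (1 / (1 + x\<^sup>2))
        = 1 / (1 + x\<^sup>2 :: real)"
      using AE_lborel_singleton[of 0] by eventually_elim (auto simp: indicator_def)
  qed measurable
qed

lemma L1_norm_pos:
  assumes "integrable lborel f" "\<not> (AE x in lborel. f x = 0)"
  shows "0 < L1_norm f"
proof -
  have "L1_norm f \<noteq> 0"
    using assms integral_nonneg_eq_0_iff_AE[OF integrable_norm[OF assms(1)]]
    by (auto simp: L1_norm_def)
  then show ?thesis
    by (simp add: L1_norm_def order_less_le)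
qed

text \<open>Dominated convergence makes the transform continuous at 0, where its value is the
  integral. As this value is nonzero, half its modulus is a strict lower bound nearby.\<close>

lemma fourier_L1_near_zero:
  assumes f: "integrable lborel f" and "(LINT x|lborel. f x) \<noteq> 0"
  obtains r where "0 < r" "\<And>\<xi>. \<bar>\<xi>\<bar> < r \<Longrightarrow> cmod (LINT x|lborel. f x) / 2 \<le> cmod (fourier_L1 f \<xi>)"
proof -
  let ?P = "LINT x|lborel. f x"
  have [measurable]: "f \<in> borel_measurable borel" using f by auto
  have "(fourier_L1 f \<longlongrightarrow> ?P) (at 0)"
    unfolding tendsto_at_iff_sequentially
  proof (intro allI impI)
    fix X :: "nat \<Rightarrow> real" assume X: "X \<longlonglongrightarrow> 0"
    show "(fourier_L1 f \<circ> X) \<longlonglongrightarrow> ?P"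
      unfolding fourier_L1_def comp_def
    proof (rule integral_dominated_convergence[where w = "\<lambda>x. norm (f x)"])
      have "(\<lambda>n. exp (- (\<i> * complex_of_real (x * X n))) * f x)
          \<longlonglongrightarrow> exp (- (\<i> * complex_of_real (x * 0))) * f x" for x
        by (intro tendsto_intros X)
      then show "AE x in lborel. (\<lambda>n. exp (- (\<i> * complex_of_real (x * X n))) * f x) \<longlonglongrightarrow> f x"
        by simp
      show "AE x in lborel. norm (exp (- (\<i> * complex_of_real (x * X n))) * f x) \<le> norm (f x)" for n
        by (auto simp: norm_mult norm_exp_eq_Re)
    qed (use f in auto)
  qed
  then have "((\<lambda>\<xi>. cmod (fourier_L1 f \<xi>)) \<longlongrightarrow> cmod ?P) (at 0)"
    by (rule tendsto_norm)
  then have "\<forall>\<^sub>F \<xi> in at 0. cmod ?P / 2 < cmod (fourier_L1 f \<xi>)"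
    using assms(2) by (intro order_tendstoD) auto
  then obtain r where r: "0 < r"
    "\<And>\<xi>. \<xi> \<noteq> 0 \<Longrightarrow> \<bar>\<xi>\<bar> < r \<Longrightarrow> cmod ?P / 2 < cmod (fourier_L1 f \<xi>)"
    by (auto simp: eventually_at)
  have "cmod ?P / 2 \<le> cmod (fourier_L1 f \<xi>)" if "\<bar>\<xi>\<bar> < r" for \<xi>
    using r(2)[OF _ that] by (cases "\<xi> = 0") (auto simp: fourier_L1_def)
  with r(1) show ?thesis using that by blast
qed

text \<open>Serves to absorb the bounded cosine term. The time beyond which this works depends on
  the data through \<open>a / c\<close>; the case \<open>a = 0\<close> allows a vanishing
  coefficient \<open>c\<close>.\<close>

lemma eventually_le_mult_sqrt:
  fixes a c :: real
  assumes "0 < c \<or> a = 0" "0 \<le> c"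
  obtains T where "1 \<le> T" "\<And>t. T \<le> t \<Longrightarrow> a \<le> c * sqrt t"
proof
  show "1 \<le> max 1 ((a / c)\<^sup>2)" by simp
  fix t assume t: "max 1 ((a / c)\<^sup>2) \<le> t"
  show "a \<le> c * sqrt t"
  proof (cases "0 < c")
    case True
    have "\<bar>a / c\<bar> \<le> sqrt t"
      using t by (intro real_le_rsqrt) (simp add: power_divide)
    then have "a / c \<le> sqrt t" by linarith
    then show ?thesis using True by (simp add: pos_divide_le_eq mult.commute)
  qed (use assms t in auto)
qed

section \<open>Bounds for the dispersion relation\<close>

definition dispersion :: "real \<Rightarrow> real \<Rightarrow> real \<Rightarrow> real \<Rightarrow> real \<Rightarrow> real" where
  "dispersion \<delta> \<mu> \<kappa> \<theta> \<xi> = sqrt ((\<mu> * \<xi> ^ 4 + \<kappa> * \<xi>\<^sup>2) / (1 + \<delta> * \<bar>\<xi>\<bar> powr (2 * \<theta>)))"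

lemma dispersion_measurable [measurable]: "dispersion \<delta> \<mu> \<kappa> \<theta> \<in> borel_measurable borel"
  unfolding dispersion_def by measurable

definition plate_params :: "real \<Rightarrow> real \<Rightarrow> real \<Rightarrow> real \<Rightarrow> bool" where
  "plate_params \<delta> \<mu> \<kappa> \<theta> \<longleftrightarrow> 0 < \<delta> \<and> 0 < \<mu> \<and> 0 < \<kappa> \<and> 0 < \<theta> \<and> \<theta> \<le> 2"

lemma plate_paramsD:
  assumes "plate_params \<delta> \<mu> \<kappa> \<theta>"
  shows "0 < \<delta>" "0 < \<mu>" "0 < \<kappa>" "0 < \<theta>" "\<theta> \<le> 2"
  using assms by (simp_all add: plate_params_def)

lemma dispersion_denominator_ge_1:
  assumes params: "plate_params \<delta> \<mu> \<kappa> \<theta>"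
  shows "1 \<le> 1 + \<delta> * \<bar>\<xi>\<bar> powr (2 * \<theta>)"
  using plate_paramsD[OF params] by simp

lemma dispersion_denominator_pos:
  assumes params: "plate_params \<delta> \<mu> \<kappa> \<theta>"
  shows "0 < 1 + \<delta> * \<bar>\<xi>\<bar> powr (2 * \<theta>)"
  using dispersion_denominator_ge_1[OF params, of \<xi>] by linarith

lemma dispersion_power2:
  assumes params: "plate_params \<delta> \<mu> \<kappa> \<theta>"
  shows "(dispersion \<delta> \<mu> \<kappa> \<theta> \<xi>)\<^sup>2 = (\<mu> * \<xi> ^ 4 + \<kappa> * \<xi>\<^sup>2) / (1 + \<delta> * \<bar>\<xi>\<bar> powr (2 * \<theta>))"
  unfolding dispersion_def using plate_paramsD[OF params] dispersion_denominator_ge_1[OF params, of \<xi>]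
  by (intro real_sqrt_pow2 divide_nonneg_nonneg add_nonneg_nonneg) auto

lemma dispersion_nonneg:
  assumes params: "plate_params \<delta> \<mu> \<kappa> \<theta>"
  shows "0 \<le> dispersion \<delta> \<mu> \<kappa> \<theta> \<xi>"
  unfolding dispersion_def using plate_paramsD[OF params] dispersion_denominator_ge_1[OF params, of \<xi>]
  by (intro real_sqrt_ge_zero divide_nonneg_nonneg add_nonneg_nonneg) auto

lemma dispersion_pos:
  assumes params: "plate_params \<delta> \<mu> \<kappa> \<theta>"
    and "\<xi> \<noteq> 0"
  shows "0 < dispersion \<delta> \<mu> \<kappa> \<theta> \<xi>"
  unfolding dispersion_def using assms(2) plate_paramsD[OF params] dispersion_denominator_ge_1[OF params, of \<xi>]
  by (intro real_sqrt_gt_zero divide_pos_pos add_pos_pos) auto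

lemma dispersion_power2_le:
  assumes params: "plate_params \<delta> \<mu> \<kappa> \<theta>"
  shows "(dispersion \<delta> \<mu> \<kappa> \<theta> \<xi>)\<^sup>2 \<le> \<mu> * \<xi> ^ 4 + \<kappa> * \<xi>\<^sup>2"
  unfolding dispersion_power2[OF params] using plate_paramsD[OF params] dispersion_denominator_pos[OF params, of \<xi>]
    divide_left_mono[OF dispersion_denominator_ge_1[OF params], of "\<mu> * \<xi> ^ 4 + \<kappa> * \<xi>\<^sup>2" \<xi>] by simp

text \<open>The quartic term is at most quadratic here, and the denominator is at least 1. The bound
  keeps \<open>t \<phi>\<close> below 1/2 on a window of width proportional to \<open>1 / t\<close>,
  on which the lower growth estimate rests.\<close>

lemma dispersion_le_linear:
  assumes params: "plate_params \<delta> \<mu> \<kappa> \<theta>"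
    and "\<bar>\<xi>\<bar> \<le> 1" shows "dispersion \<delta> \<mu> \<kappa> \<theta> \<xi> \<le> sqrt (\<mu> + \<kappa>) * \<bar>\<xi>\<bar>"
proof (rule power2_le_imp_le)
  have "\<xi>\<^sup>2 \<le> 1" using assms by (simp add: abs_square_le_1)
  then have "\<xi> ^ 4 \<le> \<xi>\<^sup>2"
    using mult_left_mono[of "\<xi>\<^sup>2" 1 "\<xi>\<^sup>2"] by (simp add: power4_eq_xxxx power2_eq_square mult.assoc)
  then have "\<mu> * \<xi> ^ 4 + \<kappa> * \<xi>\<^sup>2 \<le> (\<mu> + \<kappa>) * \<xi>\<^sup>2"
    using plate_paramsD[OF params] by (simp add: distrib_right)
  then show "(dispersion \<delta> \<mu> \<kappa> \<theta> \<xi>)\<^sup>2 \<le> (sqrt (\<mu> + \<kappa>) * \<bar>\<xi>\<bar>)\<^sup>2"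
    using dispersion_power2_le[OF params, of \<xi>] plate_paramsD[OF params] by (simp add: power_mult_distrib)
qed (use plate_paramsD[OF params] in simp)

lemma dispersion_power2_ge_low:
  assumes params: "plate_params \<delta> \<mu> \<kappa> \<theta>"
    and "\<bar>\<xi>\<bar> \<le> 1"
  shows "min \<kappa> \<mu> / (1 + \<delta>) * \<xi>\<^sup>2 \<le> (dispersion \<delta> \<mu> \<kappa> \<theta> \<xi>)\<^sup>2"
proof -
  have "\<bar>\<xi>\<bar> powr (2 * \<theta>) \<le> 1"
    using assms plate_paramsD[OF params] by (intro powr_le1) auto
  then have "1 + \<delta> * \<bar>\<xi>\<bar> powr (2 * \<theta>) \<le> 1 + \<delta>"
    using plate_paramsD[OF params] by simp
  moreover have "min \<kappa> \<mu> * \<xi>\<^sup>2 \<le> \<mu> * \<xi> ^ 4 + \<kappa> * \<xi>\<^sup>2"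
    using plate_paramsD[OF params] mult_right_mono[of "min \<kappa> \<mu>" \<kappa> "\<xi>\<^sup>2"] by (simp add: add_increasing)
  ultimately have "min \<kappa> \<mu> * \<xi>\<^sup>2 / (1 + \<delta>) \<le> (\<mu> * \<xi> ^ 4 + \<kappa> * \<xi>\<^sup>2) / (1 + \<delta> * \<bar>\<xi>\<bar> powr (2 * \<theta>))"
    using plate_paramsD[OF params] dispersion_denominator_pos[OF params, of \<xi>] by (intro frac_le add_nonneg_nonneg) simp_all
  then show ?thesis by (simp add: dispersion_power2[OF params])
qed

text \<open>Here \<open>\<theta> \<le> 2\<close> enters: the denominator grows no faster than
  \<open>\<xi>^4\<close>, so the frequency does not decay to 0 at infinity. The constant is that of
  the low-frequency bound, so that one \<open>c\<close> serves both ranges.\<close>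

lemma dispersion_power2_ge_high:
  assumes params: "plate_params \<delta> \<mu> \<kappa> \<theta>"
    and "1 \<le> \<bar>\<xi>\<bar>"
  shows "min \<kappa> \<mu> / (1 + \<delta>) \<le> (dispersion \<delta> \<mu> \<kappa> \<theta> \<xi>)\<^sup>2"
proof -
  have "\<bar>\<xi>\<bar> powr (2 * \<theta>) \<le> \<bar>\<xi>\<bar> powr 4"
    using assms plate_paramsD[OF params] by (intro powr_mono) auto
  also have "\<bar>\<xi>\<bar> powr 4 = \<xi> ^ 4"
    using assms powr_realpow[of "\<bar>\<xi>\<bar>" 4] by simp
  finally have le: "\<bar>\<xi>\<bar> powr (2 * \<theta>) \<le> \<xi> ^ 4" .
  have ge: "1 \<le> \<xi> ^ 4"
    using one_le_power[OF assms(2), of 4] by simp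
  have "1 + \<delta> * \<bar>\<xi>\<bar> powr (2 * \<theta>) \<le> (1 + \<delta>) * \<xi> ^ 4"
    using add_mono[OF ge mult_left_mono[OF le, of \<delta>]] plate_paramsD[OF params] by (simp add: distrib_right)
  then have "min \<kappa> \<mu> * \<xi> ^ 4 / ((1 + \<delta>) * \<xi> ^ 4)
      \<le> (\<mu> * \<xi> ^ 4 + \<kappa> * \<xi>\<^sup>2) / (1 + \<delta> * \<bar>\<xi>\<bar> powr (2 * \<theta>))"
    using plate_paramsD[OF params] dispersion_denominator_pos[OF params, of \<xi>] mult_right_mono[of "min \<kappa> \<mu>" \<mu> "\<xi> ^ 4"]
    by (intro frac_le) (auto simp: add_increasing2)
  then show ?thesis
    using assms by (auto simp: dispersion_power2[OF params] split: if_splits)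
qed

text \<open>Divided by its leading coefficient, the mild equation is the oscillator system for the
  transforms of \<open>w\<close>, \<open>u\<close>, \<open>v\<close>, with that of \<open>u1\<close>
  as \<open>q\<close>. But \<open>L2_oscillator_solution\<close> wants a positive bounded frequency,
  whereas the dispersion vanishes at 0 and is unbounded for \<open>\<theta> < 2\<close>. So
  everything is restricted to \<open>[-n, n]\<close> without 0, and countably many such bands cover
  almost every frequency.\<close>

lemma mild_solution_fourier:
  assumes params: "plate_params \<delta> \<mu> \<kappa> \<theta>"
    and mild: "mild_solution \<delta> \<mu> \<kappa> \<theta> u0 u1 u" and u1: "u1 \<in> sobolev \<theta>" and T: "0 \<le> T"
  shows "AE \<xi> in lborel. fourier_L2 (u T) \<xi> =
    complex_of_real (cos (T * dispersion \<delta> \<mu> \<kappa> \<theta> \<xi>)) * fourier_L2 (u 0) \<xi>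
    + complex_of_real (sin (T * dispersion \<delta> \<mu> \<kappa> \<theta> \<xi>) / dispersion \<delta> \<mu> \<kappa> \<theta> \<xi>) * fourier_L2 u1 \<xi>"
proof -
  obtain v w where C1: "C1_sobolev \<theta> u v" "C1_sobolev 2 w u" and w0: "AE x in lborel. w 0 x = 0"
    and eq: "\<And>t. 0 \<le> t \<Longrightarrow> AE \<xi> in lborel.
      complex_of_real (1 + \<delta> * \<bar>\<xi>\<bar> powr (2 * \<theta>)) * (fourier_L2 (v t) \<xi> - fourier_L2 u1 \<xi>)
      + complex_of_real (\<mu> * \<xi> ^ 4 + \<kappa> * \<xi>\<^sup>2) * fourier_L2 (w t) \<xi> = 0"
    using mild by (auto simp: mild_solution_def)
  let ?\<phi> = "dispersion \<delta> \<mu> \<kappa> \<theta>"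
  have mem: "fourier_L2 (u t) \<in> L2_space" "fourier_L2 (v t) \<in> L2_space" "fourier_L2 (w t) \<in> L2_space"
    "fourier_L2 u1 \<in> L2_space" if "0 \<le> t" for t
    using C1_sobolev_mem[OF C1(1) that] C1_sobolev_mem[OF C1(2) that] u1 by (auto intro: fourier_L2_in_L2)
  have V: "AE \<xi> in lborel. fourier_L2 (v t) \<xi> = fourier_L2 u1 \<xi> - complex_of_real ((?\<phi> \<xi>)\<^sup>2) * fourier_L2 (w t) \<xi>"
    if "0 \<le> t" for t
    using eq[OF that]
  proof eventually_elim
    case (elim \<xi>)
    define a where "a = complex_of_real (1 + \<delta> * \<bar>\<xi>\<bar> powr (2 * \<theta>))"
    define b where "b = complex_of_real (\<mu> * \<xi> ^ 4 + \<kappa> * \<xi>\<^sup>2)"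
    have a: "a \<noteq> 0"
      using dispersion_denominator_ge_1[OF params, of \<xi>] unfolding a_def of_real_eq_0_iff by linarith
    have "complex_of_real ((?\<phi> \<xi>)\<^sup>2) = b / a"
      unfolding dispersion_power2[OF params] a_def b_def by (rule of_real_divide)
    moreover have "a * (fourier_L2 (v t) \<xi> - fourier_L2 u1 \<xi>) + b * fourier_L2 (w t) \<xi> = 0"
      using elim unfolding a_def b_def .
    then have "a * (fourier_L2 (v t) \<xi> - fourier_L2 u1 \<xi>) = - (b * fourier_L2 (w t) \<xi>)"
      by (simp add: add_eq_0_iff2)
    then have "fourier_L2 (v t) \<xi> - fourier_L2 u1 \<xi> = - (b * fourier_L2 (w t) \<xi>) / a"
      using a by (metis nonzero_mult_div_cancel_left)
    ultimately show ?case
      by (simp add: diff_eq_eq)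
  qed
  have "AE \<xi> in lborel. \<xi> \<in> {-real n..real n} - {0} \<longrightarrow> fourier_L2 (u T) \<xi> =
    complex_of_real (cos (T * ?\<phi> \<xi>)) * fourier_L2 (u 0) \<xi>
    + complex_of_real (sin (T * ?\<phi> \<xi>) / ?\<phi> \<xi>) * fourier_L2 u1 \<xi>" for n
  proof -
    define B where "B = {-real n..real n} - {0}"
    \<comment> \<open>The value 1 off \<open>B\<close> keeps \<open>\<psi>\<close> positive and
      bounded; the restricted functions vanish there, so they satisfy the equation
      trivially.\<close>
    define \<psi> where "\<psi> = (\<lambda>\<xi>. if \<xi> \<in> B then ?\<phi> \<xi> else 1)"
    define M where "M = max 1 (sqrt (\<mu> * real n ^ 4 + \<kappa> * (real n)\<^sup>2))"
    let ?i = "\<lambda>f \<xi>. indicator B \<xi> * (f \<xi> :: complex)"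
    have [measurable]: "B \<in> sets borel" by (simp add: B_def)
    have i_L2: "f \<in> L2_space \<Longrightarrow> ?i f \<in> L2_space" for f
      by (rule L2_space_mult_bounded[where C = 1]) (auto simp: indicator_def)
    \<comment> \<open>Restriction to \<open>B\<close> commutes with difference quotients and does
      not increase the L^2 norm, so L^2 differentiability survives.\<close>
    have i_tendsto: "((\<lambda>\<tau>. L2_norm (\<lambda>\<xi>. (?i (a \<tau>) \<xi> - ?i (a t) \<xi>) /\<^sub>R (\<tau> - t) - ?i b \<xi>)) \<longlongrightarrow> 0) (at t within {0..})"
      if lim: "((\<lambda>\<tau>. L2_norm (\<lambda>\<xi>. (a \<tau> \<xi> - a t \<xi>) /\<^sub>R (\<tau> - t) - b \<xi>)) \<longlongrightarrow> 0) (at t within {0..})"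
        and a: "\<And>\<tau>. 0 \<le> \<tau> \<Longrightarrow> a \<tau> \<in> L2_space" and b: "b \<in> L2_space" and t: "0 \<le> t"
      for a :: "real \<Rightarrow> real \<Rightarrow> complex" and b t
    proof (rule Lim_null_comparison[OF _ lim])
      have "L2_norm (\<lambda>\<xi>. (?i (a \<tau>) \<xi> - ?i (a t) \<xi>) /\<^sub>R (\<tau> - t) - ?i b \<xi>)
          \<le> 1 * L2_norm (\<lambda>\<xi>. (a \<tau> \<xi> - a t \<xi>) /\<^sub>R (\<tau> - t) - b \<xi>)" if \<tau>: "0 \<le> \<tau>" for \<tau>
      proof (rule L2_norm_bound)
        show L: "(\<lambda>\<xi>. (a \<tau> \<xi> - a t \<xi>) /\<^sub>R (\<tau> - t) - b \<xi>) \<in> L2_space"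
          unfolding scaleR_conv_of_real by (intro L2_space_diff L2_space_cmult a b t \<tau>)
        note [measurable] = L2_space_measurable[OF a[OF t]] L2_space_measurable[OF a[OF \<tau>]]
          L2_space_measurable[OF b]
        show "(\<lambda>\<xi>. (?i (a \<tau>) \<xi> - ?i (a t) \<xi>) /\<^sub>R (\<tau> - t) - ?i b \<xi>) \<in> borel_measurable borel"
          by measurable
        show "AE \<xi> in lborel. cmod ((?i (a \<tau>) \<xi> - ?i (a t) \<xi>) /\<^sub>R (\<tau> - t) - ?i b \<xi>)
            \<le> 1 * cmod ((a \<tau> \<xi> - a t \<xi>) /\<^sub>R (\<tau> - t) - b \<xi>)"
          by (intro always_eventually allI) (simp add: indicator_def)
      qed simp
      then show "\<forall>\<^sub>F \<tau> in at t within {0..}.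
          norm (L2_norm (\<lambda>\<xi>. (?i (a \<tau>) \<xi> - ?i (a t) \<xi>) /\<^sub>R (\<tau> - t) - ?i b \<xi>))
          \<le> L2_norm (\<lambda>\<xi>. (a \<tau> \<xi> - a t \<xi>) /\<^sub>R (\<tau> - t) - b \<xi>)"
        by (auto simp: eventually_at_filter)
    qed
    have "AE \<xi> in lborel. ?i (fourier_L2 (u T)) \<xi> =
      complex_of_real (cos (T * \<psi> \<xi>)) * ?i (fourier_L2 (u 0)) \<xi>
      + complex_of_real (sin (T * \<psi> \<xi>) / \<psi> \<xi>) * ?i (fourier_L2 u1) \<xi>"
    proof (rule L2_oscillator_solution[where M = M and V = "\<lambda>t. ?i (fourier_L2 (v t))"
          and W = "\<lambda>t. ?i (fourier_L2 (w t))" and U = "\<lambda>t. ?i (fourier_L2 (u t))" and \<phi> = \<psi>])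
      show "\<psi> \<in> borel_measurable borel"
        unfolding \<psi>_def by measurable
      show "0 < \<psi> \<xi>" for \<xi>
        using dispersion_pos[OF params, of \<xi>] by (auto simp: \<psi>_def B_def)
      show "\<psi> \<xi> \<le> M" for \<xi>
      proof (cases "\<xi> \<in> B")
        case True
        then have "\<bar>\<xi>\<bar> \<le> real n" by (auto simp: B_def)
        then have pw: "\<bar>\<xi>\<bar> ^ k \<le> real n ^ k" for k
          by (rule power_mono) simp
        have "\<mu> * \<xi> ^ 4 + \<kappa> * \<xi>\<^sup>2 \<le> \<mu> * real n ^ 4 + \<kappa> * (real n)\<^sup>2"
          using plate_paramsD[OF params] pw[of 4] pw[of 2] by (intro add_mono mult_left_mono) simp_all
        then have "?\<phi> \<xi> \<le> sqrt (\<mu> * real n ^ 4 + \<kappa> * (real n)\<^sup>2)"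
          using dispersion_power2_le[OF params, of \<xi>] by (intro real_le_rsqrt) simp
        then show ?thesis using True by (simp add: \<psi>_def M_def)
      qed (simp add: \<psi>_def M_def)
      show "AE \<xi> in lborel. ?i (fourier_L2 (v t)) \<xi> =
          ?i (fourier_L2 u1) \<xi> - complex_of_real ((\<psi> \<xi>)\<^sup>2) * ?i (fourier_L2 (w t)) \<xi>" if "0 \<le> t" for t
        using V[OF that] by eventually_elim (auto simp: \<psi>_def indicator_def)
      have "AE \<xi> in lborel. fourier_L2 (w 0) \<xi> = 0"
        by (rule fourier_L2_AE_zero[OF sobolev_has_fourier[OF C1_sobolev_mem(1)[OF C1(2)]] w0]) simp
      then show "AE \<xi> in lborel. ?i (fourier_L2 (w 0)) \<xi> = 0"
        by eventually_elim simp
      fix t :: real assume t: "0 \<le> t"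
      show "((\<lambda>\<tau>. L2_norm (\<lambda>\<xi>. (?i (fourier_L2 (w \<tau>)) \<xi> - ?i (fourier_L2 (w t)) \<xi>) /\<^sub>R (\<tau> - t)
          - ?i (fourier_L2 (u t)) \<xi>)) \<longlongrightarrow> 0) (at t within {0..})"
        by (rule i_tendsto[where a = "\<lambda>t. fourier_L2 (w t)"])
          (use C1_sobolev_fourier_tendsto[OF C1(2) _ t] mem t in auto)
      show "((\<lambda>\<tau>. L2_norm (\<lambda>\<xi>. (?i (fourier_L2 (u \<tau>)) \<xi> - ?i (fourier_L2 (u t)) \<xi>) /\<^sub>R (\<tau> - t)
          - ?i (fourier_L2 (v t)) \<xi>)) \<longlongrightarrow> 0) (at t within {0..})"
        by (rule i_tendsto[where a = "\<lambda>t. fourier_L2 (u t)"])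
          (use C1_sobolev_fourier_tendsto[OF C1(1) _ t] plate_paramsD[OF params] mem t in auto)
    qed (use T mem in \<open>auto intro: i_L2\<close>)
    then show ?thesis
      by eventually_elim (auto simp: \<psi>_def B_def)
  qed
  then have "AE \<xi> in lborel. \<forall>n. \<xi> \<in> {-real n..real n} - {0} \<longrightarrow> fourier_L2 (u T) \<xi> =
    complex_of_real (cos (T * ?\<phi> \<xi>)) * fourier_L2 (u 0) \<xi>
    + complex_of_real (sin (T * ?\<phi> \<xi>) / ?\<phi> \<xi>) * fourier_L2 u1 \<xi>"
    by (intro AE_all_countable[THEN iffD2] allI)
  moreover have "AE \<xi> in lborel. \<xi> \<noteq> (0::real)"
    by (rule AE_lborel_singleton)
  ultimately show ?thesis
  proof eventually_elim
    case (elim \<xi>)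
    obtain n where "\<bar>\<xi>\<bar> \<le> real n" using real_arch_simple by blast
    then have "\<xi> \<in> {-real n..real n} - {0}" using elim(2) by auto
    then show ?case using elim(1) by blast
  qed
qed

section \<open>The multiplier of the initial velocity\<close>

definition wave_multiplier :: "real \<Rightarrow> real \<Rightarrow> real \<Rightarrow> real \<Rightarrow> real \<Rightarrow> real \<Rightarrow> real" where
  "wave_multiplier \<delta> \<mu> \<kappa> \<theta> t \<xi> = sin (t * dispersion \<delta> \<mu> \<kappa> \<theta> \<xi>) / dispersion \<delta> \<mu> \<kappa> \<theta> \<xi>"

lemma wave_multiplier_measurable [measurable]: "wave_multiplier \<delta> \<mu> \<kappa> \<theta> t \<in> borel_measurable borel"
  unfolding wave_multiplier_def by measurable

text \<open>From \<open>\<bar>sin x\<bar> \<le> \<bar>x\<bar>\<close>. Where the dispersion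
  vanishes, division by zero makes the multiplier 0, so the bound holds there too.\<close>

lemma abs_wave_multiplier_le:
  assumes params: "plate_params \<delta> \<mu> \<kappa> \<theta>"
    and "0 \<le> t"
  shows "\<bar>wave_multiplier \<delta> \<mu> \<kappa> \<theta> t \<xi>\<bar> \<le> t"
  using assms(2) dispersion_nonneg[OF params, of \<xi>] abs_sin_x_le_abs_x[of "t * dispersion \<delta> \<mu> \<kappa> \<theta> \<xi>"]
  by (cases "dispersion \<delta> \<mu> \<kappa> \<theta> \<xi> = 0") (auto simp: wave_multiplier_def abs_mult pos_divide_le_eq)

text \<open>This is \<open>\<bar>sin x\<bar> \<le> 1\<close>, kept in product form to cover the
  zeros of the dispersion.\<close>

lemma wave_multiplier_power2_mult: "(wave_multiplier \<delta> \<mu> \<kappa> \<theta> t \<xi>)\<^sup>2 * (dispersion \<delta> \<mu> \<kappa> \<theta> \<xi>)\<^sup>2 \<le> 1"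
  by (cases "dispersion \<delta> \<mu> \<kappa> \<theta> \<xi> = 0") (auto simp: wave_multiplier_def power_divide abs_square_le_1)

lemma wave_multiplier_mult_L2:
  assumes params: "plate_params \<delta> \<mu> \<kappa> \<theta>"
    and "0 \<le> t" "q \<in> L2_space"
  shows "(\<lambda>\<xi>. complex_of_real (wave_multiplier \<delta> \<mu> \<kappa> \<theta> t \<xi>) * q \<xi>) \<in> L2_space"
  using abs_wave_multiplier_le[OF params assms(2)]
  by (intro L2_space_mult_bounded[OF assms(3), where C = t]) simp_all

text \<open>At low frequencies \<open>min t\<^sup>2 (1 / (c \<xi>\<^sup>2)) \<le> 2 t\<^sup>2 / (1 + c t\<^sup>2 \<xi>\<^sup>2)\<close>, whose integral is
  proportional to \<open>t\<close>; at high frequencies the multiplier is bounded.\<close>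

lemma L2_norm_wave_multiplier_le:
  assumes params: "plate_params \<delta> \<mu> \<kappa> \<theta>"
  shows "\<exists>D>0. \<forall>t q J. 1 \<le> t \<longrightarrow> q \<in> L2_space \<longrightarrow> (AE \<xi> in lborel. cmod (q \<xi>) \<le> J) \<longrightarrow> 0 \<le> J
    \<longrightarrow> L2_norm (\<lambda>\<xi>. complex_of_real (wave_multiplier \<delta> \<mu> \<kappa> \<theta> t \<xi>) * q \<xi>) \<le> D * (L2_norm q + J) * sqrt t"
proof -
  define c where "c = min \<kappa> \<mu> / (1 + \<delta>)"
  have c: "0 < c" using plate_paramsD[OF params] by (simp add: c_def)
  define I0 where "I0 = (LINT x::real|lborel. 1 / (1 + x\<^sup>2))"
  have I0: "0 \<le> I0" unfolding I0_def by simp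
  \<comment> \<open>The first summand is the low-frequency contribution, measured by
    \<open>J\<close>, and the second the high-frequency one, measured by
    \<open>L2_norm q\<close>.\<close>
  define D where "D = sqrt (2 * I0 / sqrt c + 1 / c)"
  have D2: "0 < 2 * I0 / sqrt c + 1 / c"
    using I0 c by (intro add_nonneg_pos) auto
  have "L2_norm (\<lambda>\<xi>. complex_of_real (wave_multiplier \<delta> \<mu> \<kappa> \<theta> t \<xi>) * q \<xi>) \<le> D * (L2_norm q + J) * sqrt t"
    if t: "1 \<le> t" and q: "q \<in> L2_space" and J: "AE \<xi> in lborel. cmod (q \<xi>) \<le> J" "0 \<le> J" for t q J
  proof -
    have t0: "0 < t" using t by simp
    \<comment> \<open>With this scale \<open>c t^2 \<xi>^2\<close> is \<open>(s \<xi>)^2\<close>,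
      and the low-frequency majorant integrates to \<open>I0 / s\<close>, of order
      \<open>1 / t\<close>.\<close>
    define s where "s = sqrt c * t"
    have s: "0 < s" using c t0 by (simp add: s_def)
    have s2: "s\<^sup>2 = c * t\<^sup>2" using c by (simp add: s_def power_mult_distrib)
    have int_s: "integrable lborel (\<lambda>\<xi>. 1 / (1 + (s * \<xi>)\<^sup>2))"
      using lborel_integrable_real_affine[OF integrable_inverse_one_plus_square, of s 0] s by simp
    have I0_s: "I0 = s * (LINT \<xi>|lborel. 1 / (1 + (s * \<xi>)\<^sup>2))"
      unfolding I0_def using lborel_integral_real_affine[of s "\<lambda>x. 1 / (1 + x\<^sup>2) :: real" 0] s by simp
    have "(L2_norm (\<lambda>\<xi>. complex_of_real (wave_multiplier \<delta> \<mu> \<kappa> \<theta> t \<xi>) * q \<xi>))\<^sup>2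
        \<le> (LINT \<xi>|lborel. 2 * t\<^sup>2 * J\<^sup>2 * (1 / (1 + (s * \<xi>)\<^sup>2)) + 1 / c * (cmod (q \<xi>))\<^sup>2)"
      unfolding L2_norm_power2
    proof (rule integral_mono_AE)
      show "integrable lborel (\<lambda>\<xi>. (cmod (complex_of_real (wave_multiplier \<delta> \<mu> \<kappa> \<theta> t \<xi>) * q \<xi>))\<^sup>2)"
        using t0 by (intro L2_space_integrable wave_multiplier_mult_L2[OF params] q) simp
      show "integrable lborel (\<lambda>\<xi>. 2 * t\<^sup>2 * J\<^sup>2 * (1 / (1 + (s * \<xi>)\<^sup>2)) + 1 / c * (cmod (q \<xi>))\<^sup>2)"
        by (intro Bochner_Integration.integrable_add integrable_mult_right int_s L2_space_integrable q)
      show "AE \<xi> in lborel. (cmod (complex_of_real (wave_multiplier \<delta> \<mu> \<kappa> \<theta> t \<xi>) * q \<xi>))\<^sup>2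
          \<le> 2 * t\<^sup>2 * J\<^sup>2 * (1 / (1 + (s * \<xi>)\<^sup>2)) + 1 / c * (cmod (q \<xi>))\<^sup>2"
        using J(1)
      proof eventually_elim
        case (elim \<xi>)
        let ?m = "(wave_multiplier \<delta> \<mu> \<kappa> \<theta> t \<xi>)\<^sup>2"
        have eq: "(cmod (complex_of_real (wave_multiplier \<delta> \<mu> \<kappa> \<theta> t \<xi>) * q \<xi>))\<^sup>2 = ?m * (cmod (q \<xi>))\<^sup>2"
          unfolding norm_mult norm_of_real by (simp only: power_mult_distrib power2_abs)
        have den: "0 < 1 + (s * \<xi>)\<^sup>2" by (simp add: add_pos_nonneg)
        show ?case
        proof (cases "\<bar>\<xi>\<bar> \<le> 1")
          case True
          have "?m * (c * \<xi>\<^sup>2) \<le> ?m * (dispersion \<delta> \<mu> \<kappa> \<theta> \<xi>)\<^sup>2"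
            unfolding c_def by (intro mult_left_mono dispersion_power2_ge_low[OF params True]) simp
          then have "?m * (c * \<xi>\<^sup>2) \<le> 1"
            using wave_multiplier_power2_mult[of \<delta> \<mu> \<kappa> \<theta> t \<xi>] by linarith
          then have "t\<^sup>2 * (?m * (c * \<xi>\<^sup>2)) \<le> t\<^sup>2"
            using mult_left_mono[of "?m * (c * \<xi>\<^sup>2)" 1 "t\<^sup>2"] by simp
          moreover have "?m \<le> t\<^sup>2"
            using power_mono[OF abs_wave_multiplier_le[OF params, of t \<xi>], of 2] t0 by simp
          ultimately have "?m * (1 + (s * \<xi>)\<^sup>2) \<le> 2 * t\<^sup>2"
            by (simp add: power_mult_distrib s2 algebra_simps)
          then have "?m \<le> 2 * t\<^sup>2 / (1 + (s * \<xi>)\<^sup>2)"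
            using den by (simp add: pos_le_divide_eq)
          moreover have "(cmod (q \<xi>))\<^sup>2 \<le> J\<^sup>2"
            using elim by (intro power_mono) auto
          ultimately have "?m * (cmod (q \<xi>))\<^sup>2 \<le> 2 * t\<^sup>2 / (1 + (s * \<xi>)\<^sup>2) * J\<^sup>2"
            by (intro mult_mono) auto
          also have "\<dots> = 2 * t\<^sup>2 * J\<^sup>2 * (1 / (1 + (s * \<xi>)\<^sup>2))" by simp
          finally show ?thesis
            unfolding eq using c by (intro add_increasing2) simp_all
        next
          case False
          then have "c \<le> (dispersion \<delta> \<mu> \<kappa> \<theta> \<xi>)\<^sup>2"
            unfolding c_def by (intro dispersion_power2_ge_high[OF params]) simp
          then have "?m * c \<le> ?m * (dispersion \<delta> \<mu> \<kappa> \<theta> \<xi>)\<^sup>2"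
            by (intro mult_left_mono) simp_all
          then have "?m * c \<le> 1"
            using wave_multiplier_power2_mult[of \<delta> \<mu> \<kappa> \<theta> t \<xi>] by linarith
          then have "?m \<le> 1 / c"
            using c by (simp add: pos_le_divide_eq)
          then have "?m * (cmod (q \<xi>))\<^sup>2 \<le> 1 / c * (cmod (q \<xi>))\<^sup>2"
            by (rule mult_right_mono) simp
          then show ?thesis
            unfolding eq using den by (intro add_increasing) simp_all
        qed
      qed
    qed
    also have "\<dots> = 2 * t\<^sup>2 * J\<^sup>2 * (I0 / s) + 1 / c * (L2_norm q)\<^sup>2"
      unfolding Bochner_Integration.integral_add[OF integrable_mult_right[OF int_s]
          integrable_mult_right[OF L2_space_integrable[OF q]]] integral_mult_right_zero
      using I0_s s by (simp add: L2_norm_power2)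
    also have "2 * t\<^sup>2 * J\<^sup>2 * (I0 / s) = 2 * I0 / sqrt c * J\<^sup>2 * t"
      using t0 c by (simp add: s_def power2_eq_square)
    \<comment> \<open>Here \<open>t \<ge> 1\<close> lets the bounded high-frequency part join the
      low-frequency part of order \<open>t\<close>.\<close>
    also have "1 / c * (L2_norm q)\<^sup>2 \<le> 1 / c * (L2_norm q)\<^sup>2 * t"
      using t c by (simp add: mult_le_cancel_left1 divide_right_mono)
    also have "2 * I0 / sqrt c * J\<^sup>2 * t + 1 / c * (L2_norm q)\<^sup>2 * t
        \<le> 2 * I0 / sqrt c * (L2_norm q + J)\<^sup>2 * t + 1 / c * (L2_norm q + J)\<^sup>2 * t"
      using I0 c t0 J(2) by (intro add_mono mult_right_mono mult_left_mono power_mono) auto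
    also have "\<dots> = (D * (L2_norm q + J) * sqrt t)\<^sup>2"
    proof -
      have "D\<^sup>2 = 2 * I0 / sqrt c + 1 / c" using D2 by (simp add: D_def)
      then show ?thesis
        using t0 by (simp add: power_mult_distrib distrib_right)
    qed
    finally show ?thesis
    proof (rule power2_le_imp_le)
      have "0 \<le> D" using D2 by (simp add: D_def)
      then show "0 \<le> D * (L2_norm q + J) * sqrt t"
        using J(2) t0 by (intro mult_nonneg_nonneg add_nonneg_nonneg) simp_all
    qed simp
  qed
  then show ?thesis
    using D2 by (intro exI[of _ D]) (simp add: D_def)
qed

text \<open>Only the window \<open>0 < \<xi> \<le> b\<close> with \<open>b = 1 / (2 F t)\<close> and
  \<open>F = sqrt (\<mu> + \<kappa>)\<close> is kept. There \<open>t \<phi> \<le> 1/2\<close>, so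
  the multiplier is at least \<open>t / 2\<close>. The two lower bounds on \<open>2 F t\<close> say
  that the window lies within radius \<open>r\<close>, where \<open>q\<close> is bounded below, and
  within radius 1, where the dispersion is at most linear.\<close>

lemma L2_norm_wave_multiplier_ge:
  assumes params: "plate_params \<delta> \<mu> \<kappa> \<theta>"
  shows "\<exists>E>0. \<forall>t r q p. 1 \<le> t \<longrightarrow> 0 < r \<longrightarrow> 1 / r \<le> 2 * sqrt (\<mu> + \<kappa>) * t \<longrightarrow> 1 \<le> 2 * sqrt (\<mu> + \<kappa>) * t
    \<longrightarrow> q \<in> L2_space \<longrightarrow> (AE \<xi> in lborel. \<bar>\<xi>\<bar> \<le> r \<longrightarrow> p / 2 \<le> cmod (q \<xi>)) \<longrightarrow> 0 \<le> p
    \<longrightarrow> E * p * sqrt t \<le> L2_norm (\<lambda>\<xi>. complex_of_real (wave_multiplier \<delta> \<mu> \<kappa> \<theta> t \<xi>) * q \<xi>)"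
proof -
  define F where "F = sqrt (\<mu> + \<kappa>)"
  have F: "0 < F" using plate_paramsD[OF params] by (simp add: F_def)
  \<comment> \<open>On a window of length \<open>1 / (2 F t)\<close> the product is at least
    \<open>t p / 4\<close>, so the squared norm is at least \<open>p^2 t / (32 F)\<close>.\<close>
  define E where "E = sqrt (1 / (32 * F))"
  have "E * p * sqrt t \<le> L2_norm (\<lambda>\<xi>. complex_of_real (wave_multiplier \<delta> \<mu> \<kappa> \<theta> t \<xi>) * q \<xi>)"
    if t: "1 \<le> t" "1 / r \<le> 2 * F * t" "1 \<le> 2 * F * t" and r: "0 < r" and q: "q \<in> L2_space"
      and p: "AE \<xi> in lborel. \<bar>\<xi>\<bar> \<le> r \<longrightarrow> p / 2 \<le> cmod (q \<xi>)" "0 \<le> p" for t r q p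
  proof -
    have t0: "0 < t" using t by simp
    define b where "b = 1 / (2 * F * t)"
    have b: "0 < b" "b \<le> r" "b \<le> 1"
      using F t t0 r by (auto simp: b_def field_simps)
    let ?f = "\<lambda>\<xi>. complex_of_real (t * p / 4 * indicator {0<..b} \<xi>)"
    have "L2_norm ?f \<le> 1 * L2_norm (\<lambda>\<xi>. complex_of_real (wave_multiplier \<delta> \<mu> \<kappa> \<theta> t \<xi>) * q \<xi>)"
    proof (rule L2_norm_bound)
      show "(\<lambda>\<xi>. complex_of_real (wave_multiplier \<delta> \<mu> \<kappa> \<theta> t \<xi>) * q \<xi>) \<in> L2_space"
        using t0 by (intro wave_multiplier_mult_L2[OF params] q) simp
      show "AE \<xi> in lborel. cmod (?f \<xi>) \<le> 1 * cmod (complex_of_real (wave_multiplier \<delta> \<mu> \<kappa> \<theta> t \<xi>) * q \<xi>)"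
        using p(1)
      proof eventually_elim
        case (elim \<xi>)
        show ?case
        proof (cases "\<xi> \<in> {0<..b}")
          case True
          let ?d = "dispersion \<delta> \<mu> \<kappa> \<theta> \<xi>"
          have d: "0 < ?d" using True dispersion_pos[OF params, of \<xi>] by simp
          have "?d \<le> F * \<bar>\<xi>\<bar>"
            unfolding F_def using True b by (intro dispersion_le_linear[OF params]) simp
          also have "\<dots> \<le> F * b" using True F by simp
          finally have "t * ?d \<le> t * (F * b)" using t0 by simp
          also have "\<dots> = 1 / 2" using F t0 by (simp add: b_def)
          finally have td: "t * ?d \<le> 1 / 2" .
          have "(t * ?d)\<^sup>2 \<le> t * ?d / 2"
            using mult_left_mono[OF td, of "t * ?d"] t0 d by (simp add: power2_eq_square)
          \<comment> \<open>The remainder estimate at \<open>y = 0\<close> reads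
            \<open>sin x \<ge> x - x^2\<close>, which is at least \<open>x / 2\<close> for
            \<open>0 \<le> x \<le> 1/2\<close>.\<close>
          then have "t * ?d / 2 \<le> sin (t * ?d)"
            using sin_Taylor_remainder[of 0 "t * ?d"] by simp
          then have "t / 2 \<le> wave_multiplier \<delta> \<mu> \<kappa> \<theta> t \<xi>"
            using d by (simp add: wave_multiplier_def pos_le_divide_eq)
          moreover have "p / 2 \<le> cmod (q \<xi>)"
            using elim True b by auto
          ultimately have "t / 2 * (p / 2) \<le> \<bar>wave_multiplier \<delta> \<mu> \<kappa> \<theta> t \<xi>\<bar> * cmod (q \<xi>)"
            using t0 p(2) by (intro mult_mono) auto
          moreover have "cmod (?f \<xi>) = t * p / 4"
            unfolding norm_of_real using True t0 p(2) by simp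
          ultimately show ?thesis
            unfolding norm_mult norm_of_real by simp
        qed simp
      qed
    qed simp_all
    moreover have "E * p * sqrt t = L2_norm ?f"
    proof -
      have "(L2_norm ?f)\<^sup>2 = (LINT \<xi>|lborel. (t * p / 4)\<^sup>2 * indicator {0<..b} \<xi>)"
        unfolding L2_norm_power2 norm_of_real
        by (intro Bochner_Integration.integral_cong refl) (simp add: indicator_def power_divide)
      also have "\<dots> = (t * p / 4)\<^sup>2 * b"
        using b by simp
      also have "\<dots> = (E * p * sqrt t)\<^sup>2"
        using F t0 by (simp add: E_def b_def power_mult_distrib power_divide) (simp add: power2_eq_square)
      finally show ?thesis
        using F p(2) t0 by (intro power2_eq_imp_eq[of "E * p * sqrt t"]) (simp_all add: E_def)
    qed
    ultimately show ?thesis by simp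
  qed
  then show ?thesis
    using F by (intro exI[of _ E]) (simp add: E_def F_def)
qed

text \<open>The cosine factor is at most 1, so the initial displacement contributes an error bounded
  uniformly in time. Both growth bounds thereby reduce to the multiplier term;
  \<open>sqrt (2 * pi)\<close> is the Plancherel factor of the unnormalised transform.\<close>

lemma mild_solution_L2_norm:
  assumes params: "plate_params \<delta> \<mu> \<kappa> \<theta>"
    and mild: "mild_solution \<delta> \<mu> \<kappa> \<theta> u0 u1 u" and u1: "u1 \<in> sobolev \<theta>" and t: "0 \<le> t"
  shows "\<bar>sqrt (2 * pi) * L2_norm (u t) - L2_norm (\<lambda>\<xi>. complex_of_real (wave_multiplier \<delta> \<mu> \<kappa> \<theta> t \<xi>) * fourier_L2 u1 \<xi>)\<bar>
    \<le> L2_norm (fourier_L2 (u 0))"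
proof -
  have u: "u t \<in> sobolev 2" "u 0 \<in> sobolev 2"
    using mild t by (auto simp: mild_solution_def continuous_sobolev_def)
  let ?K = "\<lambda>\<xi>. complex_of_real (wave_multiplier \<delta> \<mu> \<kappa> \<theta> t \<xi>) * fourier_L2 u1 \<xi>"
  have K: "?K \<in> L2_space"
    by (intro wave_multiplier_mult_L2[OF params] t fourier_L2_in_L2[OF u1])
  note L2 = fourier_L2_in_L2[OF u(1)] fourier_L2_in_L2[OF u(2)]
  note [measurable] = L2[THEN L2_space_measurable] K[THEN L2_space_measurable]
  have "\<bar>L2_norm (fourier_L2 (u t)) - L2_norm ?K\<bar> \<le> L2_norm (\<lambda>\<xi>. fourier_L2 (u t) \<xi> - ?K \<xi>)"
    by (rule L2_norm_reverse_triangle[OF L2(1) K])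
  also have "\<dots> \<le> 1 * L2_norm (fourier_L2 (u 0))"
  proof (rule L2_norm_bound[OF L2(2)])
    show "AE \<xi> in lborel. cmod (fourier_L2 (u t) \<xi> - ?K \<xi>) \<le> 1 * cmod (fourier_L2 (u 0) \<xi>)"
      using mild_solution_fourier[OF params mild u1 t]
    proof eventually_elim
      case (elim \<xi>)
      then have "fourier_L2 (u t) \<xi> - ?K \<xi>
          = complex_of_real (cos (t * dispersion \<delta> \<mu> \<kappa> \<theta> \<xi>)) * fourier_L2 (u 0) \<xi>"
        by (simp add: wave_multiplier_def)
      then show ?case
        by (simp add: norm_mult mult_left_le_one_le)
    qed
  qed simp_all
  finally show ?thesis
    by (simp add: Plancherel_L2[OF sobolev_has_fourier[OF u(1)]])
qed

text \<open>The disjunction excludes a null \<open>u1\<close> with a non-null \<open>u0\<close>: the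
  right-hand side would then be 0, while the cosine term carried by \<open>u0\<close>
  persists.\<close>

lemma mild_solution_growth_upper:
  assumes params: "plate_params \<delta> \<mu> \<kappa> \<theta>"
  shows "\<exists>C1>0. \<forall>u0 u1 u.
    u0 \<in> sobolev 2 \<and> u1 \<in> sobolev \<theta> \<inter> L1_space \<and>
    mild_solution \<delta> \<mu> \<kappa> \<theta> u0 u1 u \<and>
    (\<not> (AE x in lborel. u1 x = 0) \<or> (AE x in lborel. u0 x = 0)) \<longrightarrow>
    (\<exists>T>0. \<forall>t\<ge>T. L2_norm (u t) \<le> C1 * (L2_norm u1 + L1_norm u1) * sqrt t)"
proof -
  obtain D where D: "0 < D" and upper: "\<forall>t q J. 1 \<le> t \<longrightarrow> q \<in> L2_space \<longrightarrow> (AE \<xi> in lborel. cmod (q \<xi>) \<le> J) \<longrightarrow> 0 \<le> J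
    \<longrightarrow> L2_norm (\<lambda>\<xi>. complex_of_real (wave_multiplier \<delta> \<mu> \<kappa> \<theta> t \<xi>) * q \<xi>) \<le> D * (L2_norm q + J) * sqrt t"
    using L2_norm_wave_multiplier_le[OF params] by auto
  let ?s = "sqrt (2 * pi)"
  have s: "0 < ?s" "1 \<le> ?s" using pi_gt3 by auto
  show ?thesis
  \<comment> \<open>\<open>D\<close> pays for the multiplier term, and 1 for the cosine term once
    \<open>sqrt t\<close> has outgrown it. The Plancherel factor, being at least 1, is pulled out of
    both and cancels.\<close>
  proof (rule exI[of _ "D + 1"], intro conjI allI impI)
    fix u0 u1 :: "real \<Rightarrow> complex" and u
    assume "u0 \<in> sobolev 2 \<and> u1 \<in> sobolev \<theta> \<inter> L1_space \<and> mild_solution \<delta> \<mu> \<kappa> \<theta> u0 u1 u \<and>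
      (\<not> (AE x in lborel. u1 x = 0) \<or> (AE x in lborel. u0 x = 0))"
    then have u1: "u1 \<in> sobolev \<theta> \<inter> L1_space" and mild: "mild_solution \<delta> \<mu> \<kappa> \<theta> u0 u1 u"
      and nontrivial: "\<not> (AE x in lborel. u1 x = 0) \<or> (AE x in lborel. u0 x = 0)"
      by blast+
    have u1s: "u1 \<in> sobolev \<theta>" and u1i: "integrable lborel u1"
      using u1 by (auto simp: L1_space_def)
    have J: "0 \<le> L1_norm u1" by (simp add: L1_norm_def)
    have q: "fourier_L2 u1 \<in> L2_space" "L2_norm (fourier_L2 u1) = ?s * L2_norm u1"
      using fourier_L2_in_L2[OF u1s] Plancherel_L2[OF sobolev_has_fourier[OF u1s]] by auto
    have qJ: "AE \<xi> in lborel. cmod (fourier_L2 u1 \<xi>) \<le> L1_norm u1"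
      using has_fourier_L2_eq_fourier_L1[OF sobolev_has_fourier[OF u1s] u1i]
      by eventually_elim (simp add: norm_fourier_L1_le)
    let ?I = "L2_norm u1 + L1_norm u1"
    \<comment> \<open>The alternative required by \<open>eventually_le_mult_sqrt\<close>: either the
      coefficient is positive or there is nothing to absorb.\<close>
    have "0 < ?I \<or> L2_norm (fourier_L2 (u 0)) = 0"
    proof (cases "AE x in lborel. u1 x = 0")
      case True
      then have u0: "AE x in lborel. u0 x = 0" using nontrivial by blast
      have u: "u 0 \<in> sobolev 2" and eq: "AE x in lborel. u 0 x = u0 x"
        using mild by (auto simp: mild_solution_def continuous_sobolev_def)
      have "AE x in lborel. u 0 x = 0"
        using eq u0 by eventually_elim simp
      then have "AE \<xi> in lborel. fourier_L2 (u 0) \<xi> = 0"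
        by (rule fourier_L2_AE_zero[OF sobolev_has_fourier[OF u]])
      then have "L2_norm (fourier_L2 (u 0)) = L2_norm (\<lambda>_. 0)"
        using fourier_L2_in_L2[OF u] by (intro L2_norm_cong_AE) auto
      then show ?thesis by (simp add: L2_norm_def)
    next
      case False
      then show ?thesis
        using L1_norm_pos[OF u1i] L2_norm_nonneg[of u1] by linarith
    qed
    then obtain T where T: "1 \<le> T" "\<And>t. T \<le> t \<Longrightarrow> L2_norm (fourier_L2 (u 0)) \<le> ?I * sqrt t"
      using eventually_le_mult_sqrt[of ?I "L2_norm (fourier_L2 (u 0))"] J
      by (metis add_nonneg_nonneg L2_norm_nonneg)
    show "\<exists>T>0. \<forall>t\<ge>T. L2_norm (u t) \<le> (D + 1) * ?I * sqrt t"
    proof (intro exI[of _ T] conjI allI impI)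
      fix t assume t: "T \<le> t"
      have "?s * L2_norm (u t) \<le> D * (?s * L2_norm u1 + L1_norm u1) * sqrt t + ?I * sqrt t"
        using mild_solution_L2_norm[OF params mild u1s, of t] upper[rule_format, OF _ q(1) qJ J, of t] T(1) T(2)[OF t] t
        unfolding q(2) by linarith
      also have "\<dots> \<le> D * (?s * ?I) * sqrt t + ?s * ?I * sqrt t"
      proof (intro add_mono mult_right_mono mult_left_mono)
        show "?s * L2_norm u1 + L1_norm u1 \<le> ?s * ?I"
          using mult_right_mono[OF s(2) J] by (simp add: distrib_left)
        show "?I \<le> ?s * ?I"
          using mult_right_mono[OF s(2), of ?I] J by simp
      qed (use D T t in auto)
      also have "\<dots> = ?s * ((D + 1) * ?I * sqrt t)"
        by (simp add: algebra_simps)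
      finally show "L2_norm (u t) \<le> (D + 1) * ?I * sqrt t"
        using s(1) by (simp only: mult_le_cancel_left_pos)
    qed (use T in simp)
  qed (use D in simp)
qed

text \<open>The radius around 0 on which F \<open>u1\<close> keeps half of its value at 0 depends on
  \<open>u1\<close>, but it only delays the time from which the frequency window of width
  \<open>1 / t\<close> fits inside.\<close>

lemma mild_solution_growth_lower:
  assumes params: "plate_params \<delta> \<mu> \<kappa> \<theta>"
  shows "\<exists>C2>0. \<forall>u0 u1 u.
    u0 \<in> sobolev 2 \<and> u1 \<in> sobolev \<theta> \<inter> weighted_L1_space \<gamma> \<and>
    mild_solution \<delta> \<mu> \<kappa> \<theta> u0 u1 u \<longrightarrow>
    (\<exists>T>0. \<forall>t\<ge>T. C2 * cmod (LINT x|lborel. u1 x) * sqrt t \<le> L2_norm (u t))"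
proof -
  let ?s = "sqrt (2 * pi)"
  have s: "0 < ?s" using pi_gt3 by simp
  obtain E where E: "0 < E" and lower: "\<forall>t r q p. 1 \<le> t \<longrightarrow> 0 < r \<longrightarrow> 1 / r \<le> 2 * sqrt (\<mu> + \<kappa>) * t
    \<longrightarrow> 1 \<le> 2 * sqrt (\<mu> + \<kappa>) * t \<longrightarrow> q \<in> L2_space
    \<longrightarrow> (AE \<xi> in lborel. \<bar>\<xi>\<bar> \<le> r \<longrightarrow> p / 2 \<le> cmod (q \<xi>)) \<longrightarrow> 0 \<le> p
    \<longrightarrow> E * p * sqrt t \<le> L2_norm (\<lambda>\<xi>. complex_of_real (wave_multiplier \<delta> \<mu> \<kappa> \<theta> t \<xi>) * q \<xi>)"
    using L2_norm_wave_multiplier_ge[OF params] by auto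
  \<comment> \<open>Half of \<open>E\<close> is spent on absorbing the cosine term;
    \<open>?s\<close> is the Plancherel factor.\<close>
  let ?C = "E / (2 * ?s)"
  show ?thesis
  proof (rule exI[of _ ?C], intro conjI allI impI)
    fix u0 u1 :: "real \<Rightarrow> complex" and u
    assume "u0 \<in> sobolev 2 \<and> u1 \<in> sobolev \<theta> \<inter> weighted_L1_space \<gamma> \<and> mild_solution \<delta> \<mu> \<kappa> \<theta> u0 u1 u"
    then have u1: "u1 \<in> sobolev \<theta> \<inter> weighted_L1_space \<gamma>" and mild: "mild_solution \<delta> \<mu> \<kappa> \<theta> u0 u1 u"
      by blast+
    have u1s: "u1 \<in> sobolev \<theta>" and u1i: "integrable lborel u1"
      using u1 by (auto simp: weighted_L1_space_def L1_space_def)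
    let ?P = "cmod (LINT x|lborel. u1 x)"
    show "\<exists>T>0. \<forall>t\<ge>T. ?C * ?P * sqrt t \<le> L2_norm (u t)"
    proof (cases "(LINT x|lborel. u1 x) = 0")
      case True
      then show ?thesis by (intro exI[of _ 1]) simp
    next
      case False
      obtain r where r: "0 < r" "\<And>\<xi>. \<bar>\<xi>\<bar> < r \<Longrightarrow> ?P / 2 \<le> cmod (fourier_L1 u1 \<xi>)"
        using fourier_L1_near_zero[OF u1i False] by blast
      \<comment> \<open>The radius is halved because the bound on \<open>fourier_L1 u1\<close> holds
        on an open interval, while the multiplier estimate asks for a closed one.\<close>
      have near: "AE \<xi> in lborel. \<bar>\<xi>\<bar> \<le> r / 2 \<longrightarrow> ?P / 2 \<le> cmod (fourier_L2 u1 \<xi>)"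
        using has_fourier_L2_eq_fourier_L1[OF sobolev_has_fourier[OF u1s] u1i]
      proof eventually_elim
        case (elim \<xi>)
        then show ?case using r(1) r(2)[of \<xi>] by auto
      qed
      have "0 < E / 2 * ?P" using E False by simp
      then obtain T where T: "1 \<le> T" "\<And>t. T \<le> t \<Longrightarrow> L2_norm (fourier_L2 (u 0)) \<le> E / 2 * ?P * sqrt t"
        using eventually_le_mult_sqrt[of "E / 2 * ?P" "L2_norm (fourier_L2 (u 0))"] by (metis less_imp_le)
      let ?F = "2 * sqrt (\<mu> + \<kappa>)"
      have F: "0 < ?F" using plate_paramsD[OF params] by simp
      \<comment> \<open>The three thresholds ensure, in this order, that the cosine term is
        absorbed, that the window lies within radius \<open>r / 2\<close>, and that it lies within
        radius 1.\<close>
      define T' where "T' = Max {T, 1 / (r / 2) / ?F, 1 / ?F}"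
      show ?thesis
      proof (intro exI[of _ T'] conjI allI impI)
        show "0 < T'" using T(1) by (simp add: T'_def)
        fix t assume "T' \<le> t"
        then have t: "T \<le> t" "1 / (r / 2) / ?F \<le> t" "1 / ?F \<le> t"
          by (simp_all add: T'_def)
        have Ft: "1 / (r / 2) \<le> ?F * t" "1 \<le> ?F * t"
          using t(2,3)[unfolded pos_divide_le_eq[OF F]] by (simp_all only: mult.commute)
        have "E * ?P * sqrt t \<le> L2_norm (\<lambda>\<xi>. complex_of_real (wave_multiplier \<delta> \<mu> \<kappa> \<theta> t \<xi>) * fourier_L2 u1 \<xi>)"
          by (rule lower[rule_format, OF _ _ Ft fourier_L2_in_L2[OF u1s] near]) (use r(1) T(1) t(1) in auto)
        then have "E * ?P * sqrt t - E / 2 * ?P * sqrt t \<le> ?s * L2_norm (u t)"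
          using mild_solution_L2_norm[OF params mild u1s, of t] T(1) T(2)[OF t(1)] t(1) by linarith
        then have "E / 2 * ?P * sqrt t / ?s \<le> L2_norm (u t)"
          unfolding pos_divide_le_eq[OF s] mult.commute[of "L2_norm (u t)"] by linarith
        then show "?C * ?P * sqrt t \<le> L2_norm (u t)" by simp
      qed
    qed
  qed (use E in simp)
qed

theorem theorem1p1:
  fixes \<delta> \<mu> \<kappa> \<theta> :: real
  assumes "\<delta> > 0" and "\<mu> > 0" and "\<kappa> > 0" and "0 < \<theta>" and "\<theta> \<le> 2"
  shows "(\<exists>C1>0. \<forall>u0 u1 u.
            u0 \<in> sobolev 2 \<and> u1 \<in> sobolev \<theta> \<inter> L1_space \<and>
            mild_solution \<delta> \<mu> \<kappa> \<theta> u0 u1 u \<and>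
            (\<not> (AE x in lborel. u1 x = 0) \<or> (AE x in lborel. u0 x = 0)) \<longrightarrow>
            (\<exists>T>0. \<forall>t\<ge>T. L2_norm (u t) \<le> C1 * (L2_norm u1 + L1_norm u1) * sqrt t))
       \<and> (\<forall>\<gamma>. 1 / 2 < \<gamma> \<and> \<gamma> \<le> 1 \<longrightarrow>
           (\<exists>C2>0. \<forall>u0 u1 u.
              u0 \<in> sobolev 2 \<and> u1 \<in> sobolev \<theta> \<inter> weighted_L1_space \<gamma> \<and>
              mild_solution \<delta> \<mu> \<kappa> \<theta> u0 u1 u \<longrightarrow>
              (\<exists>T>0. \<forall>t\<ge>T. C2 * cmod (LINT x|lborel. u1 x) * sqrt t \<le> L2_norm (u t))))"
proof -
  have "plate_params \<delta> \<mu> \<kappa> \<theta>"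
    using assms by (simp add: plate_params_def)
  then show ?thesis
    by (intro conjI allI impI mild_solution_growth_upper mild_solution_growth_lower)
qed

end
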